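(* If $\mathcal A$ is a regular algebra with mean value in $\mathbb R^n$, then $\mathcal A$ is ergodic.
   Context: $\mathrm{BUC}(\mathbb R^n)$ is the space of bounded uniformly continuous real functions on $\mathbb R^n$ with the sup norm. $g\in L^1_{\rm loc}(\mathbb R^n)$ has mean value $M(g)$ if $\lim_{\varepsilon\to0}\int_A g(x/\varepsilon)\,dx=|A|M(g)$ for every bounded Lebesgue measurable $A\subseteq\mathbb R^n$. An algebra with mean value is a linear subspace $\mathcal A$ of $\mathrm{BUC}(\mathbb R^n)$ closed under products, invariant under all translations $\tau_yf=f(\cdot+y)$, closed in the sup norm, containing the constant function $1$, and each element of which has a mean value. $\mathcal B^2$ is the completion of $\mathcal A$ for the seminorm $M(|f|^2)^{1/2}$; $M$ and $\tau_y$ extend to it by continuity. $\mathcal A$ is ergodic if every $f\in\mathcal B^2$ with $M(|\tau_yf-f|^2)=0$ for all $y\in\mathbb R^n$ is equal in $\mathcal B^2$ to a constant. Let $V(\mathcal A)=\{f\in\mathcal A:M(f)=0\}$ and $Z(\mathcal A)=\{f\in\mathcal A:\operatorname{supp}\hat f\text{ is compact and }0\notin\operatorname{supp}\hat f\}$, where $\hat f$ is the distributional Fourier transform $\langle\hat f,\phi\rangle=\int f\hat\phi\,dx$, $\phi\in C_c^\infty(\mathbb R^n)$. $\mathcal A$ is regular if $Z(\mathcal A)$ is dense in $V(\mathcal A)$ in the sup norm. *)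

theory Defs
  imports "HOL-Analysis.Analysis"
begin

definition locally_integrable :: "(real^'n \<Rightarrow> real) \<Rightarrow> bool" where
  "locally_integrable g \<longleftrightarrow> (\<forall>K. compact K \<longrightarrow> set_integrable lebesgue K g)"

definition has_mean_value :: "(real^'n \<Rightarrow> real) \<Rightarrow> real \<Rightarrow> bool" where
  "has_mean_value g m \<longleftrightarrow> locally_integrable g \<and>
     (\<forall>S. bounded S \<and> S \<in> sets lebesgue \<longrightarrow>
        ((\<lambda>\<epsilon>. set_lebesgue_integral lebesgue S (\<lambda>x. g (x /\<^sub>R \<epsilon>)))
           \<longlongrightarrow> measure lebesgue S * m) (at_right 0))"

definition mean_value :: "(real^'n \<Rightarrow> real) \<Rightarrow> real" where
  "mean_value g = (THE m. has_mean_value g m)"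

text \<open>The norm of the library type \<open>_ \<Rightarrow>\<^sub>C _\<close> of bounded continuous functions is the sup norm, so
  closedness and closure in this type refer to uniform convergence.\<close>

definition BUC :: "((real^'n) \<Rightarrow>\<^sub>C real) set" where
  "BUC = {f. uniformly_continuous_on UNIV (apply_bcontfun f)}"

context includes bcontfun.lifting begin

lift_definition bcf_mult ::
  "((real^'n) \<Rightarrow>\<^sub>C real) \<Rightarrow> ((real^'n) \<Rightarrow>\<^sub>C real) \<Rightarrow> ((real^'n) \<Rightarrow>\<^sub>C real)"
  is "\<lambda>f g x. f x * g x"
proof -
  fix f g :: "real^'n \<Rightarrow> real"
  assume f: "f \<in> bcontfun" and g: "g \<in> bcontfun"
  obtain a b where ab: "\<And>x. norm (f x) \<le> a" "\<And>x. norm (g x) \<le> b"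
    using f g by (auto simp: bcontfun_def bounded_iff)
  have "norm (f x * g x) \<le> a * b" for x
    unfolding norm_mult using ab order_trans[OF norm_ge_zero ab(1)] by (intro mult_mono) auto
  then show "(\<lambda>x. f x * g x) \<in> bcontfun"
    using f g by (auto simp: bcontfun_def bounded_iff intro!: continuous_intros)
qed

lift_definition translate ::
  "real^'n \<Rightarrow> ((real^'n) \<Rightarrow>\<^sub>C real) \<Rightarrow> ((real^'n) \<Rightarrow>\<^sub>C real)"
  is "\<lambda>y f x. f (x + y)"
proof -
  fix y :: "real^'n" and f :: "real^'n \<Rightarrow> real"
  assume f: "f \<in> bcontfun"
  have "continuous_on UNIV (\<lambda>x. f (x + y))"
    using f by (auto simp: bcontfun_def intro!: continuous_on_compose2[of UNIV f] continuous_intros)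
  then show "(\<lambda>x. f (x + y)) \<in> bcontfun"
    using f by (auto simp: bcontfun_def bounded_iff)
qed

end

definition algebra_with_mean_value :: "((real^'n) \<Rightarrow>\<^sub>C real) set \<Rightarrow> bool" where
  "algebra_with_mean_value A \<longleftrightarrow>
     A \<subseteq> BUC \<and> subspace A \<and>
     (\<forall>f\<in>A. \<forall>g\<in>A. bcf_mult f g \<in> A) \<and>
     (\<forall>y. \<forall>f\<in>A. translate y f \<in> A) \<and>
     closed A \<and>
     const_bcontfun 1 \<in> A \<and>
     (\<forall>f\<in>A. \<exists>m. has_mean_value (apply_bcontfun f) m)"

definition mean_sq :: "((real^'n) \<Rightarrow>\<^sub>C real) \<Rightarrow> real" where
  "mean_sq f = mean_value (\<lambda>x. \<bar>f x\<bar>\<^sup>2)"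

definition b2_seminorm :: "((real^'n) \<Rightarrow>\<^sub>C real) \<Rightarrow> real" where
  "b2_seminorm f = sqrt (mean_sq f)"

definition b2_cauchy :: "((real^'n) \<Rightarrow>\<^sub>C real) set \<Rightarrow> (nat \<Rightarrow> (real^'n) \<Rightarrow>\<^sub>C real) set" where
  "b2_cauchy A = {u. (\<forall>k. u k \<in> A) \<and>
     (\<forall>e>0. \<exists>N. \<forall>j\<ge>N. \<forall>k\<ge>N. b2_seminorm (u j - u k) < e)}"

definition b2_rel ::
  "((real^'n) \<Rightarrow>\<^sub>C real) set \<Rightarrow> ((nat \<Rightarrow> (real^'n) \<Rightarrow>\<^sub>C real) \<times> (nat \<Rightarrow> (real^'n) \<Rightarrow>\<^sub>C real)) set" where
  "b2_rel A = {(u, v). u \<in> b2_cauchy A \<and> v \<in> b2_cauchy A \<and>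
     (\<lambda>k. b2_seminorm (u k - v k)) \<longlonglongrightarrow> 0}"

text \<open>An element of the completion is a class of Cauchy sequences in \<open>A\<close>; operations on classes are
  lifted from representatives as in \<open>HOL.Equiv_Relations\<close>.\<close>

definition B2 :: "((real^'n) \<Rightarrow>\<^sub>C real) set \<Rightarrow> (nat \<Rightarrow> (real^'n) \<Rightarrow>\<^sub>C real) set set" where
  "B2 A = b2_cauchy A // b2_rel A"

definition b2_const ::
  "((real^'n) \<Rightarrow>\<^sub>C real) set \<Rightarrow> real \<Rightarrow> (nat \<Rightarrow> (real^'n) \<Rightarrow>\<^sub>C real) set" where
  "b2_const A c = b2_rel A `` {\<lambda>k. const_bcontfun c}"

definition b2_translate ::
  "((real^'n) \<Rightarrow>\<^sub>C real) set \<Rightarrow> real^'n \<Rightarrow> (nat \<Rightarrow> (real^'n) \<Rightarrow>\<^sub>C real) set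
     \<Rightarrow> (nat \<Rightarrow> (real^'n) \<Rightarrow>\<^sub>C real) set" where
  "b2_translate A y F = (\<Union>u\<in>F. b2_rel A `` {\<lambda>k. translate y (u k)})"

definition b2_diff ::
  "((real^'n) \<Rightarrow>\<^sub>C real) set \<Rightarrow> (nat \<Rightarrow> (real^'n) \<Rightarrow>\<^sub>C real) set
     \<Rightarrow> (nat \<Rightarrow> (real^'n) \<Rightarrow>\<^sub>C real) set \<Rightarrow> (nat \<Rightarrow> (real^'n) \<Rightarrow>\<^sub>C real) set" where
  "b2_diff A F G = (\<Union>u\<in>F. \<Union>v\<in>G. b2_rel A `` {\<lambda>k. u k - v k})"

text \<open>The extension by continuity of \<open>mean_sq\<close>: the common limit along all representatives.\<close>

definition b2_mean_sq :: "(nat \<Rightarrow> (real^'n) \<Rightarrow>\<^sub>C real) set \<Rightarrow> real" where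
  "b2_mean_sq F = (THE m. \<forall>u\<in>F. (\<lambda>k. mean_sq (u k)) \<longlonglongrightarrow> m)"

definition ergodic :: "((real^'n) \<Rightarrow>\<^sub>C real) set \<Rightarrow> bool" where
  "ergodic A \<longleftrightarrow>
     (\<forall>F\<in>B2 A. (\<forall>y. b2_mean_sq (b2_diff A (b2_translate A y F) F) = 0)
        \<longrightarrow> (\<exists>c. F = b2_const A c))"

fun Ck :: "nat \<Rightarrow> (real^'n \<Rightarrow> complex) \<Rightarrow> bool" where
  "Ck 0 \<phi> \<longleftrightarrow> continuous_on UNIV \<phi>"
| "Ck (Suc k) \<phi> \<longleftrightarrow> (\<forall>x. \<phi> differentiable (at x)) \<and>
     (\<forall>v. Ck k (\<lambda>x. frechet_derivative \<phi> (at x) v))"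

definition fun_supp :: "(real^'n \<Rightarrow> complex) \<Rightarrow> (real^'n) set" where
  "fun_supp \<phi> = closure {x. \<phi> x \<noteq> 0}"

definition test_functions :: "(real^'n \<Rightarrow> complex) set" where
  "test_functions = {\<phi>. (\<forall>k. Ck k \<phi>) \<and> compact (fun_supp \<phi>)}"

text \<open>Other normalisations only rescale the support of \<open>fourier_dist f\<close>, so compactness and
  \<open>0 \<notin> supp\<close> do not depend on the convention.\<close>

definition fourier :: "(real^'n \<Rightarrow> complex) \<Rightarrow> real^'n \<Rightarrow> complex" where
  "fourier \<phi> \<xi> = (LINT x|lebesgue. exp (- \<i> * complex_of_real (x \<bullet> \<xi>)) * \<phi> x)"

definition fourier_dist :: "(real^'n \<Rightarrow> real) \<Rightarrow> (real^'n \<Rightarrow> complex) \<Rightarrow> complex" where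
  "fourier_dist f \<phi> = (LINT x|lebesgue. complex_of_real (f x) * fourier \<phi> x)"

definition dist_supp :: "((real^'n \<Rightarrow> complex) \<Rightarrow> complex) \<Rightarrow> (real^'n) set" where
  "dist_supp T = - \<Union>{U. open U \<and> (\<forall>\<phi>\<in>test_functions. fun_supp \<phi> \<subseteq> U \<longrightarrow> T \<phi> = 0)}"

definition V_space :: "((real^'n) \<Rightarrow>\<^sub>C real) set \<Rightarrow> ((real^'n) \<Rightarrow>\<^sub>C real) set" where
  "V_space A = {f \<in> A. mean_value (apply_bcontfun f) = 0}"

definition Z_space :: "((real^'n) \<Rightarrow>\<^sub>C real) set \<Rightarrow> ((real^'n) \<Rightarrow>\<^sub>C real) set" where
  "Z_space A = {f \<in> A. compact (dist_supp (fourier_dist (apply_bcontfun f))) \<and>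
     0 \<notin> dist_supp (fourier_dist (apply_bcontfun f))}"

definition regular :: "((real^'n) \<Rightarrow>\<^sub>C real) set \<Rightarrow> bool" where
  "regular A \<longleftrightarrow> V_space A \<subseteq> closure (Z_space A)"

end

theory Submission
  imports Defs "HOL-Probability.Probability" "HOL-Computational_Algebra.Polynomial"
begin

text \<open>Let \<open>u\<close> be a Cauchy sequence representing a translation invariant element. The functional
  \<open>L g = lim M (u\<^sub>n g)\<close> on \<open>A\<close> is then translation invariant. If the spectrum of \<open>g\<close> avoids a
  neighbourhood of 0, let \<open>k\<close> be the Fourier transform of a bump function supported there. Then
  \<open>\<integral> k(y) g(x + y) dy = 0\<close> for all \<open>x\<close>, while \<open>\<integral> k \<noteq> 0\<close> by Fourier inversion; applying \<open>L\<close> gives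
  \<open>L g \<cdot> \<integral> k = 0\<close>, so \<open>L g = 0\<close>. By regularity \<open>L\<close> vanishes on \<open>V(A)\<close>, in particular on
  \<open>u\<^sub>n - M(u\<^sub>n)\<close>, which forces the variances \<open>M(u\<^sub>n\<^sup>2) - M(u\<^sub>n)\<^sup>2\<close> to tend to 0.\<close>

section \<open>Smooth bump functions\<close>

text \<open>The convolution of \<open>g\<close> with \<open>k\<close> is never formed as an element
  of the algebra, which avoids vector-valued integration. Only the scalar function
  \<open>y \<mapsto> ip (u n) (translate y g)\<close> is integrated against \<open>k\<close>. Its
  values are limits of integrals over scaled balls, so its measurability and the interchange of
  \<open>M\<close> with the integral come from Fubini for those integrals, followed by dominated
  convergence. Fourier inversion enters at the single point 0 and for a kernel of our own choosing.
  A product of one-dimensional bumps reduces it to the line, where two integrations by parts make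
  the transform integrable. The last step meets a diagonal problem: the elements
  \<open>u n - M (u n)\<close> change with n, while L is itself a limit in n. The Cauchy property
  allows the element to be frozen at one index, with an error uniform in later n.\<close>

lemma Ck_Suc_imp: "Ck (Suc k) f \<Longrightarrow> Ck k f"
proof (induction k arbitrary: f)
  case 0
  then show ?case
    by (auto intro!: continuous_at_imp_continuous_on differentiable_imp_continuous_within)
next
  case (Suc k)
  then show ?case by (metis Ck.simps(2))
qed

lemma Ck_const: "Ck k (\<lambda>x. c)"
  by (induction k arbitrary: c) auto

lemma Ck_add: "Ck k f \<Longrightarrow> Ck k g \<Longrightarrow> Ck k (\<lambda>x. f x + g x)"
proof (induction k arbitrary: f g)
  case 0
  then show ?case by (auto intro!: continuous_intros)
next
  case (Suc k)
  have "frechet_derivative (\<lambda>x. f x + g x) (at x) =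
      (\<lambda>v. frechet_derivative f (at x) v + frechet_derivative g (at x) v)" for x
    using Suc.prems
    by (intro frechet_derivative_at[symmetric] derivative_intros) (auto simp: frechet_derivative_works)
  then show ?case using Suc by (auto intro!: differentiable_add)
qed

text \<open>The product rule keeps one factor undifferentiated in each term, so the induction
  hypothesis needs \<open>f\<close> and \<open>g\<close> themselves at level \<open>k\<close>;
  \<open>Ck_Suc_imp\<close> supplies this.\<close>

lemma Ck_mult: "Ck k f \<Longrightarrow> Ck k g \<Longrightarrow> Ck k (\<lambda>x. f x * g x)"
proof (induction k arbitrary: f g)
  case 0
  then show ?case by (auto intro!: continuous_intros)
next
  case (Suc k)
  have "frechet_derivative (\<lambda>x. f x * g x) (at x) =
      (\<lambda>v. f x * frechet_derivative g (at x) v + frechet_derivative f (at x) v * g x)" for x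
    using Suc.prems
    by (intro frechet_derivative_at[symmetric] derivative_intros) (auto simp: frechet_derivative_works)
  then show ?case using Suc Ck_Suc_imp[OF Suc.prems(1)] Ck_Suc_imp[OF Suc.prems(2)]
    by (auto intro!: differentiable_mult Ck_add)
qed

lemma Ck_prod: "finite I \<Longrightarrow> (\<And>i. i \<in> I \<Longrightarrow> Ck k (f i)) \<Longrightarrow> Ck k (\<lambda>x. \<Prod>i\<in>I. f i x)"
  by (induction I rule: finite_induct) (auto intro: Ck_const Ck_mult)

text \<open>Every directional derivative is the character times a constant depending only on the
  direction, so the induction closes.\<close>

lemma Ck_character:
  fixes y :: "real^'n"
  shows "Ck k (\<lambda>x. exp (- \<i> * complex_of_real (y \<bullet> x)))"
proof (induction k)
  case 0
  show ?case by (auto intro!: continuous_intros)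
next
  case (Suc k)
  have d: "((\<lambda>x. exp (- \<i> * complex_of_real (y \<bullet> x))) has_derivative
      (\<lambda>v. exp (- \<i> * complex_of_real (y \<bullet> x)) * (- \<i> * complex_of_real (y \<bullet> v)))) (at x)" for x :: "real^'n"
    by (rule has_derivative_compose[OF _ DERIV_exp[unfolded has_field_derivative_def]])
       (auto intro!: derivative_eq_intros)
  show ?case
    using Ck_mult[OF Suc Ck_const] by (auto simp only: Ck.simps frechet_derivative_at[OF d, symmetric] intro: differentiableI[OF d])
qed

text \<open>Carrying the whole sequence of derivatives turns the induction on \<open>k\<close> into
  a shift of \<open>j\<close>. The coefficient \<open>c\<close> will be 1 and -1, for the two
  factors of \<open>bump\<close>.\<close>

lemma Ck_of_real_affine_nth:
  fixes B :: "nat \<Rightarrow> real \<Rightarrow> real" and i :: "'n::finite"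
  assumes B: "\<And>j x. (B j has_real_derivative B (Suc j) x) (at x)"
  shows "Ck k (\<lambda>x. complex_of_real (B j (a + c * x $ i)))"
proof (induction k arbitrary: j)
  case 0
  have "continuous_on UNIV (B j)"
    using B by (meson DERIV_continuous_on has_field_derivative_at_within)
  then show ?case
    by (auto intro!: continuous_intros continuous_on_compose2[of UNIV "B j"])
next
  case (Suc k)
  have d: "((\<lambda>x. complex_of_real (B j (a + c * x $ i))) has_derivative
      (\<lambda>v. complex_of_real (B (Suc j) (a + c * x $ i)) * complex_of_real (c * v $ i))) (at x)" for x :: "real^'n"
  proof -
    have "((\<lambda>x. B j (a + c * x $ i)) has_derivative
      (\<lambda>v. B (Suc j) (a + c * x $ i) * (c * v $ i))) (at x)"
      by (rule has_derivative_compose[where g="B j" and f="\<lambda>x. a + c * x $ i", OF _ B[unfolded has_field_derivative_def], simplified])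
         (auto intro!: derivative_eq_intros bounded_linear_imp_has_derivative bounded_linear_vec_nth)
    then show ?thesis
      by (auto dest: has_derivative_of_real)
  qed
  show ?case
    using d by (auto simp: frechet_derivative_at[OF d, symmetric] simp del: of_real_mult
        intro!: Ck_mult Ck_const Suc differentiableI)
qed

section \<open>A flat function with explicit derivatives of all orders\<close>

lemma poly_div_exp_tendsto_0: "((\<lambda>x. poly p x / exp x) \<longlongrightarrow> (0::real)) at_top"
proof -
  have "((\<lambda>x. \<Sum>i\<le>degree p. coeff p i * (x ^ i / exp x)) \<longlongrightarrow> (\<Sum>i\<le>degree p. coeff p i * 0)) at_top"
    by (intro tendsto_intros tendsto_power_div_exp_0)
  then show ?thesis
    by (simp add: poly_altdef sum_divide_distrib)
qed

text \<open>The classical flat function exp(-1/x) with a polynomial factor in 1/x, which makes the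
  family closed under differentiation.\<close>

definition exp_flat :: "real poly \<Rightarrow> real \<Rightarrow> real" where
  "exp_flat p x = (if x > 0 then poly p (inverse x) * exp (- inverse x) else 0)"

text \<open>With t = 1/x, differentiating p(t) exp(-t) in x gives t^2 (p - p')(t) exp(-t); the two
  \<open>pCons 0\<close> are the factor t^2. At 0 the exponential beats every polynomial in
  t.\<close>

lemma exp_flat_has_real_derivative:
  "(exp_flat p has_real_derivative exp_flat (pCons 0 (pCons 0 (p - pderiv p))) x) (at x)"
proof -
  consider "x > 0" | "x < 0" | "x = 0" by linarith
  then show ?thesis
  proof cases
    case 1
    have "((\<lambda>x. poly p (inverse x) * exp (- inverse x)) has_real_derivative
       exp_flat (pCons 0 (pCons 0 (p - pderiv p))) x) (at x)"
      using 1
      by (auto intro!: derivative_eq_intros DERIV_chain2[where f="poly p"] poly_DERIV simp: exp_flat_def algebra_simps power2_eq_square)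
    then show ?thesis
      by (rule has_field_derivative_transform_within_open[where S="{0<..}"]) (auto simp: 1 exp_flat_def)
  next
    case 2
    have "((\<lambda>x. 0) has_real_derivative exp_flat (pCons 0 (pCons 0 (p - pderiv p))) x) (at x)"
      using 2 by (auto simp: exp_flat_def)
    then show ?thesis
      by (rule has_field_derivative_transform_within_open[where S="{..<0}"]) (auto simp: 2 exp_flat_def)
  next
    case 3
    \<comment> \<open>With t = 1/h the right difference quotient at 0 is t p(t) / exp t;
      \<open>pCons 0 p\<close> absorbs the extra t coming from the division by h.\<close>
    have "((\<lambda>h. poly (pCons 0 p) (inverse h) / exp (inverse h)) \<longlongrightarrow> 0) (at_right 0)"
      by (rule filterlim_compose[OF poly_div_exp_tendsto_0 filterlim_inverse_at_top_right])
    then have "((\<lambda>h. exp_flat p h / h) \<longlongrightarrow> 0) (at_right 0)"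
      by (rule Lim_transform_eventually)
         (auto simp: eventually_at_filter exp_flat_def exp_minus divide_inverse)
    moreover have "((\<lambda>h. exp_flat p h / h) \<longlongrightarrow> 0) (at_left 0)"
      by (rule Lim_transform_eventually[OF tendsto_const])
         (auto simp: eventually_at_filter exp_flat_def)
    ultimately have "((\<lambda>h. exp_flat p h / h) \<longlongrightarrow> 0) (at 0)"
      by (rule filterlim_split_at[rotated])
    then show ?thesis
      using 3 by (simp add: has_field_derivative_iff exp_flat_def)
  qed
qed

text \<open>The recursion of \<open>exp_flat_has_real_derivative\<close> started at the constant
  polynomial 1, giving the sequence that \<open>Ck_of_real_affine_nth\<close> asks for.\<close>

definition exp_flat_deriv :: "nat \<Rightarrow> real \<Rightarrow> real" where
  "exp_flat_deriv j = exp_flat (((\<lambda>p. pCons 0 (pCons 0 (p - pderiv p))) ^^ j) 1)"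

lemma exp_flat_deriv_has_real_derivative:
  "(exp_flat_deriv j has_real_derivative exp_flat_deriv (Suc j) x) (at x)"
  unfolding exp_flat_deriv_def by (simp add: exp_flat_has_real_derivative)

lemma exp_flat_deriv_nonpos: "x \<le> 0 \<Longrightarrow> exp_flat_deriv j x = 0"
  by (simp add: exp_flat_deriv_def exp_flat_def)

lemma exp_flat_deriv_0_pos: "x > 0 \<Longrightarrow> exp_flat_deriv 0 x > 0"
  by (simp add: exp_flat_deriv_def exp_flat_def)

text \<open>Each factor cuts off one half line, and smoothness passes to the product.\<close>

definition bump :: "real \<Rightarrow> real \<Rightarrow> real" where
  "bump \<delta> x = exp_flat_deriv 0 (\<delta> + x) * exp_flat_deriv 0 (\<delta> - x)"

lemma bump_eq_0: "\<bar>x\<bar> \<ge> \<delta> \<Longrightarrow> bump \<delta> x = 0"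
  unfolding bump_def by (cases "x \<ge> 0") (auto simp: exp_flat_deriv_nonpos)

lemma bump_0_pos: "\<delta> > 0 \<Longrightarrow> bump \<delta> 0 > 0"
  by (simp add: bump_def exp_flat_deriv_0_pos)

text \<open>A product over coordinates instead of a radial bump, so that its Fourier transform
  factorises into transforms on the line.\<close>

definition bump_tensor :: "real \<Rightarrow> real^'n \<Rightarrow> complex" where
  "bump_tensor \<delta> x = (\<Prod>i\<in>UNIV. complex_of_real (bump \<delta> (x $ i)))"

lemma Ck_bump_tensor: "Ck k (bump_tensor \<delta> :: real^'n \<Rightarrow> complex)"
proof -
  have "Ck k (\<lambda>x::real^'n. \<Prod>i\<in>UNIV. complex_of_real (exp_flat_deriv 0 (\<delta> + 1 * x $ i)) *
      complex_of_real (exp_flat_deriv 0 (\<delta> + (-1) * x $ i)))"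
    by (intro Ck_prod Ck_mult Ck_of_real_affine_nth exp_flat_deriv_has_real_derivative) auto
  then show ?thesis
    by (simp add: bump_tensor_def[abs_def] bump_def)
qed

text \<open>The function lives on a cube of half-width \<delta>; bounding the Euclidean norm by the
  l1 norm costs the factor \<open>CARD('n)\<close>.\<close>

lemma bump_tensor_nonzero_imp_small:
  fixes x :: "real^'n" and \<delta> :: real
  assumes "bump_tensor \<delta> x \<noteq> 0"
  shows "norm x \<le> CARD('n) * \<delta>"
proof -
  have "\<bar>x $ i\<bar> < \<delta>" for i
  proof (rule ccontr)
    assume "\<not> \<bar>x $ i\<bar> < \<delta>"
    then have "bump \<delta> (x $ i) = 0" by (intro bump_eq_0) simp
    then show False using assms by (auto simp: bump_tensor_def prod_zero_iff)
  qed
  then have "(\<Sum>i\<in>UNIV. \<bar>x $ i\<bar>) \<le> (\<Sum>i\<in>(UNIV::'n set). \<delta>)"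
    by (intro sum_mono less_imp_le)
  then show ?thesis using norm_le_l1_cart[of x] by simp
qed

text \<open>A character has no zeros, so modulation leaves the support in place, while on the
  Fourier side it translates. One spectral gap therefore annihilates all translates of one
  kernel.\<close>

lemma modulated_bump_tensor_test_function:
  fixes y :: "real^'n" and \<delta> :: real
  defines "\<phi> \<equiv> \<lambda>x. exp (- \<i> * complex_of_real (y \<bullet> x)) * bump_tensor \<delta> x"
  shows "\<phi> \<in> test_functions" "fun_supp \<phi> \<subseteq> cball 0 (CARD('n) * \<delta>)"
proof -
  have "{x. \<phi> x \<noteq> 0} \<subseteq> cball 0 (CARD('n) * \<delta>)"
    by (auto simp: \<phi>_def dest: bump_tensor_nonzero_imp_small)
  then show s: "fun_supp \<phi> \<subseteq> cball 0 (CARD('n) * \<delta>)"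
    unfolding fun_supp_def by (intro closure_minimal) auto
  have "compact (fun_supp \<phi>)"
    using s bounded_subset[OF bounded_cball] by (auto simp: compact_eq_bounded_closed fun_supp_def)
  moreover have "Ck k \<phi>" for k
    unfolding \<phi>_def by (intro Ck_mult Ck_character Ck_bump_tensor)
  ultimately show "\<phi> \<in> test_functions"
    by (auto simp: test_functions_def)
qed

section \<open>The Fourier transform on the line\<close>

lemma integrable_pair_mult:
  fixes f :: "'a \<Rightarrow> real" and g :: "'b \<Rightarrow> real"
  assumes "pair_sigma_finite M N" and f: "integrable M f" and g: "integrable N g"
  shows "integrable (M \<Otimes>\<^sub>M N) (\<lambda>(x, y). f x * g y)"
proof -
  interpret pair_sigma_finite M N by fact
  have [measurable]: "f \<in> borel_measurable M" "g \<in> borel_measurable N"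
    using f g by auto
  show ?thesis
    using f g by (intro Fubini_integrable) (auto simp: abs_mult)
qed

lemma continuous_compact_support_integrable_lborel:
  fixes f :: "real \<Rightarrow> 'a::euclidean_space"
  assumes "continuous_on UNIV f" "\<And>x. x \<notin> {a..b} \<Longrightarrow> f x = 0"
  shows "integrable lborel f"
proof -
  have "set_integrable lborel {a..b} f"
    by (rule borel_integrable_atLeastAtMost') (rule continuous_on_subset[OF assms(1)], simp)
  moreover have "(\<lambda>x. indicator {a..b} x *\<^sub>R f x) = f"
    using assms(2) by (auto simp: indicator_def fun_eq_iff)
  ultimately show ?thesis by (simp add: set_integrable_def)
qed

text \<open>Integration by parts without boundary terms. Supports are confined to the open interval
  so that \<open>F\<close> vanishes at \<open>a\<close> and \<open>b\<close> themselves.\<close>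

lemma integral_lborel_derivative_compact_support:
  fixes F :: "real \<Rightarrow> 'a::euclidean_space"
  assumes F: "\<And>x. (F has_vector_derivative f x) (at x)" and f: "continuous_on UNIV f"
    and supp: "\<And>x. x \<notin> {a<..<b} \<Longrightarrow> F x = 0" "\<And>x. x \<notin> {a<..<b} \<Longrightarrow> f x = 0" and "a \<le> b"
  shows "(LINT x|lborel. f x) = 0"
proof -
  have "(LINT x|lborel. indicator {a..b} x *\<^sub>R f x) = F b - F a"
    using F f \<open>a \<le> b\<close>
    by (intro integral_FTC_Icc) (auto intro: has_vector_derivative_at_within continuous_on_subset)
  moreover have "(\<lambda>x. indicator {a..b} x *\<^sub>R f x) = f"
    using supp(2) by (auto simp: indicator_def fun_eq_iff)
  ultimately show ?thesis using supp(1) by simp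
qed

lemma integrable_inverse_1_plus_square_lborel: "integrable lborel (\<lambda>x::real. inverse (1 + x\<^sup>2))"
  using integrable_inverse_1_plus_square by (simp add: set_integrable_def)

definition fourier_real :: "(real \<Rightarrow> real) \<Rightarrow> real \<Rightarrow> complex" where
  "fourier_real b t = (LINT s|lborel. exp (- \<i> * complex_of_real (s * t)) * complex_of_real (b s))"

text \<open>Two integrations by parts trade two derivatives of \<open>b\<close> for decay of order
  1/t^2, and 1/(1 + t^2) is integrable.\<close>

lemma fourier_real_integrable:
  fixes b b1 b2 :: "real \<Rightarrow> real"
  assumes d1: "\<And>x. (b has_real_derivative b1 x) (at x)"
    and d2: "\<And>x. (b1 has_real_derivative b2 x) (at x)"
    and c2: "continuous_on UNIV b2"
    and supp: "\<And>x. x \<notin> {-\<delta><..<\<delta>} \<Longrightarrow> b x = 0" "\<And>x. x \<notin> {-\<delta><..<\<delta>} \<Longrightarrow> b1 x = 0"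
      "\<And>x. x \<notin> {-\<delta><..<\<delta>} \<Longrightarrow> b2 x = 0" and "\<delta> \<ge> 0"
  shows "integrable lborel (fourier_real b)"
proof -
  have cont: "continuous_on UNIV b" "continuous_on UNIV b1"
    using d1 d2 by (meson DERIV_continuous_on has_field_derivative_at_within)+
  \<comment> \<open>Sum of two L1 norms, because \<open>(1 + t\<^sup>2)\<close> times the modulus of
    the transform of \<open>b\<close> is the sum of the moduli of the transforms of \<open>b\<close>
    and \<open>b2\<close>.\<close>
  define C where "C = (LINT s|lborel. \<bar>b s\<bar>) + (LINT s|lborel. \<bar>b2 s\<bar>)"
  have intb: "integrable lborel b" "integrable lborel b2"
    using cont c2 supp by (auto intro!: continuous_compact_support_integrable_lborel[where a="-\<delta>" and b=\<delta>])
  have [measurable]: "b \<in> borel_measurable borel" "b2 \<in> borel_measurable borel"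
    using cont c2 by (auto intro: borel_measurable_continuous_onI)
  have inte: "integrable lborel (\<lambda>s. exp (- \<i> * complex_of_real (s * t)) * complex_of_real (g s))"
    if "integrable lborel g" for g t
    by (rule Bochner_Integration.integrable_bound[OF that])
       (use borel_measurable_integrable[OF that] in \<open>auto simp: norm_mult\<close>)
  have nrm: "norm (fourier_real g t) \<le> (LINT s|lborel. \<bar>g s\<bar>)" if "integrable lborel g" for g t
    unfolding fourier_real_def
    by (rule order_trans[OF integral_norm_bound]) (simp add: norm_mult)
  have parts: "fourier_real b2 t + t\<^sup>2 * fourier_real b t = 0" for t
  proof -
    let ?e = "\<lambda>s. exp (- \<i> * complex_of_real (s * t))"
    \<comment> \<open>Both integrations by parts at once: in the derivative of
      \<open>?e s * (b1 s + \<i> * t * b s)\<close> the two terms with \<open>b1\<close>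
      cancel.\<close>
    have "(LINT s|lborel. ?e s * (b2 s + t\<^sup>2 * b s)) = 0"
    proof (rule integral_lborel_derivative_compact_support[where a="-\<delta>" and b=\<delta>
          and F="\<lambda>s. ?e s * (b1 s + \<i> * t * b s)"])
      fix x
      have e: "(?e has_vector_derivative (- \<i> * t * ?e x)) (at x)"
      proof -
        have "((\<lambda>s. - \<i> * complex_of_real (s * t)) has_vector_derivative - \<i> * t) (at x)"
          unfolding has_vector_derivative_def
          by (auto intro!: derivative_eq_intros simp: scaleR_conv_of_real)
        from field_vector_diff_chain_at[OF this DERIV_exp]
        show ?thesis by (simp add: o_def)
      qed
      have b: "((\<lambda>s. complex_of_real (b s)) has_vector_derivative b1 x) (at x)"
        "((\<lambda>s. complex_of_real (b1 s)) has_vector_derivative b2 x) (at x)"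
        using d1[of x] d2[of x]
        by (auto intro!: has_vector_derivative_of_real simp: has_real_derivative_iff_has_vector_derivative)
      show "((\<lambda>s. ?e s * (b1 s + \<i> * t * b s)) has_vector_derivative ?e x * (b2 x + t\<^sup>2 * b x)) (at x)"
        by (rule has_vector_derivative_eq_rhs[OF has_vector_derivative_mult[OF e
             has_vector_derivative_add[OF b(2) has_vector_derivative_mult[OF has_vector_derivative_const b(1)]]]])
           (simp add: algebra_simps power2_eq_square)
    qed (use supp \<open>\<delta> \<ge> 0\<close> cont c2 in \<open>auto intro!: continuous_intros\<close>)
    also have "(\<lambda>s. ?e s * (b2 s + t\<^sup>2 * b s)) = (\<lambda>s. ?e s * b2 s + t\<^sup>2 * (?e s * b s))"
      by (auto simp: algebra_simps)
    finally show ?thesis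
      unfolding fourier_real_def
      using Bochner_Integration.integral_add[OF inte[OF intb(2)] integrable_mult_right[OF inte[OF intb(1)]]]
      by simp
  qed
  have bound: "norm (fourier_real b t) \<le> C * inverse (1 + t\<^sup>2)" for t
  proof -
    have "t\<^sup>2 * fourier_real b t = - fourier_real b2 t"
      using parts[of t] by (simp add: add_eq_0_iff)
    then have "t\<^sup>2 * norm (fourier_real b t) = norm (fourier_real b2 t)"
      by (metis norm_minus_cancel norm_mult norm_of_real of_real_power abs_power2)
    then have "(1 + t\<^sup>2) * norm (fourier_real b t) \<le> C"
      using nrm[OF intb(1), of t] nrm[OF intb(2), of t] by (simp add: C_def algebra_simps)
    then show ?thesis
      by (simp add: field_simps add_pos_nonneg)
  qed
  have "fourier_real b \<in> borel_measurable lborel"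
    unfolding fourier_real_def[abs_def]
    by measurable
  then show ?thesis
    using bound by (intro Bochner_Integration.integrable_bound[OF
       integrable_mult_right[OF integrable_inverse_1_plus_square_lborel, of C]])
      (auto intro!: AE_I2 order_trans[OF bound] mult_right_mono simp: abs_mult)
qed

text \<open>Damping by \<open>exp (- (\<epsilon> t)\<^sup>2 / 2)\<close> makes Fubini applicable; the transform of the Gaussian is an
  approximate identity that picks out the value at 0.\<close>

lemma integral_fourier_real:
  fixes b :: "real \<Rightarrow> real"
  assumes b: "integrable lborel b" and cont: "continuous_on UNIV b" and bd: "\<And>x. \<bar>b x\<bar> \<le> C"
    and F: "integrable lborel (fourier_real b)"
  shows "(LINT t|lborel. fourier_real b t) = 2 * pi * b 0"
proof -
  let ?N = "std_normal_density"
  have [measurable]: "b \<in> borel_measurable borel"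
    using cont by (auto intro: borel_measurable_continuous_onI)
  have char: "(LINT t|lborel. complex_of_real (?N t) * exp (\<i> * complex_of_real (x * t))) = exp (- x\<^sup>2 / 2)" for x
  proof -
    have "char std_normal_distribution x = (LINT t|lborel. ?N t *\<^sub>R exp (\<i> * complex_of_real (x * t)))"
      unfolding char_def by (subst integral_density) (auto simp: normal_density_nonneg)
    then show ?thesis
      by (simp add: char_std_normal_distribution scaleR_conv_of_real)
  qed
  have key: "(LINT t|lborel. exp (- (\<epsilon> * t)\<^sup>2 / 2) * fourier_real b t)
        = (LINT r|lborel. (2 * pi) * (?N r * b (\<epsilon> * r)))" if "\<epsilon> > 0" for \<epsilon> :: real
  proof -
    let ?G = "\<lambda>t. exp (- (\<epsilon> * t)\<^sup>2 / 2)"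
    let ?f = "\<lambda>t s. complex_of_real (?G t) * (exp (- \<i> * complex_of_real (s * t)) * complex_of_real (b s))"
    \<comment> \<open>The damping factor as a rescaled normal density; the summand 0 matches the
      shape of the affine substitution rule.\<close>
    have G: "?G t = sqrt (2 * pi) * ?N (0 + \<epsilon> * t)" for t
      by (simp add: std_normal_density_def)
    have intG: "integrable lborel ?G"
      unfolding G using that
      by (intro integrable_mult_right lborel_integrable_real_affine[of ?N]) auto
    have "integrable (lborel \<Otimes>\<^sub>M lborel) (\<lambda>(t, s). ?G t * b s)"
      by (intro integrable_pair_mult lborel_pair.pair_sigma_finite_axioms intG b)
    then have int: "integrable (lborel \<Otimes>\<^sub>M lborel) (\<lambda>(t, s). ?f t s)"
      by (rule Bochner_Integration.integrable_bound) (auto simp: norm_mult)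
    \<comment> \<open>Substituting r = \<epsilon> t gives 1/\<epsilon>. One
      \<open>sqrt (2 * pi)\<close> comes from the damping factor, the other from writing the
      resulting Gaussian in s as a density again.\<close>
    have inner: "(LINT t|lborel. ?f t s) = complex_of_real (2 * pi / \<epsilon> * (?N (s / \<epsilon>) * b s))" for s
    proof -
      have "(LINT t|lborel. ?f t s) = \<bar>1 / \<epsilon>\<bar> *\<^sub>R (LINT r|lborel. ?f (0 + 1 / \<epsilon> * r) s)"
        using that by (intro lborel_integral_real_affine) auto
      also have "(\<lambda>r. ?f (0 + 1 / \<epsilon> * r) s) =
          (\<lambda>r. complex_of_real (sqrt (2 * pi) * b s) * (complex_of_real (?N r) * exp (\<i> * complex_of_real ((- s / \<epsilon>) * r))))"
        unfolding G using that by (auto simp: fun_eq_iff algebra_simps)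
      also have "(LINT r|lborel. complex_of_real (sqrt (2 * pi) * b s) * (complex_of_real (?N r) * exp (\<i> * complex_of_real ((- s / \<epsilon>) * r))))
          = complex_of_real (sqrt (2 * pi) * b s) * exp (- (- s / \<epsilon>)\<^sup>2 / 2)"
        by (simp only: integral_mult_right_zero char)
      also have "exp (- (- s / \<epsilon>)\<^sup>2 / 2) = sqrt (2 * pi) * ?N (s / \<epsilon>)"
        by (simp add: std_normal_density_def)
      finally show ?thesis
        using that by (simp add: scaleR_conv_of_real mult_ac flip: of_real_mult)
    qed
    have "(LINT t|lborel. ?G t * fourier_real b t) = (LINT t|lborel. LINT s|lborel. ?f t s)"
      by (simp add: fourier_real_def)
    also have "\<dots> = (LINT s|lborel. LINT t|lborel. ?f t s)"
      by (rule lborel_pair.Fubini_integral[symmetric, OF int])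
    also have "\<dots> = complex_of_real (LINT s|lborel. 2 * pi / \<epsilon> * (?N (s / \<epsilon>) * b s))"
      unfolding inner by (rule integral_complex_of_real)
    also have "(LINT s|lborel. 2 * pi / \<epsilon> * (?N (s / \<epsilon>) * b s)) =
        \<bar>\<epsilon>\<bar> *\<^sub>R (LINT r|lborel. 2 * pi / \<epsilon> * (?N ((0 + \<epsilon> * r) / \<epsilon>) * b (0 + \<epsilon> * r)))"
      using that by (intro lborel_integral_real_affine) auto
    also have "\<dots> = (LINT r|lborel. (2 * pi) * (?N r * b (\<epsilon> * r)))"
      using that by simp
    finally show ?thesis .
  qed
  \<comment> \<open>Dominated convergence is stated for sequences; \<open>Suc\<close> keeps the
    scale positive at n = 0.\<close>
  define e where "e = (\<lambda>n. 1 / real (Suc n))"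
  have e: "e n > 0" for n by (simp add: e_def)
  have elim: "e \<longlonglongrightarrow> 0" unfolding e_def by (rule LIMSEQ_Suc) (rule lim_1_over_n)
  have 1: "(\<lambda>n. LINT t|lborel. exp (- (e n * t)\<^sup>2 / 2) * fourier_real b t) \<longlonglongrightarrow> (LINT t|lborel. fourier_real b t)"
  proof (rule integral_dominated_convergence[where w="\<lambda>t. norm (fourier_real b t)"])
    show "AE x in lborel. (\<lambda>n. exp (- (e n * x)\<^sup>2 / 2) * fourier_real b x) \<longlonglongrightarrow> fourier_real b x"
    proof (intro AE_I2)
      fix x
      have "(\<lambda>n. exp (- (e n * x)\<^sup>2 / 2)) \<longlonglongrightarrow> exp (- (0 * x)\<^sup>2 / 2)"
        by (intro tendsto_intros elim) auto
      from tendsto_mult[OF tendsto_of_real[OF this] tendsto_const[of "fourier_real b x"]]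
      show "(\<lambda>n. exp (- (e n * x)\<^sup>2 / 2) * fourier_real b x) \<longlonglongrightarrow> fourier_real b x" by simp
    qed
    have "norm (exp (- (e n * x)\<^sup>2 / 2) * fourier_real b x) \<le> norm (fourier_real b x)" for n x
      unfolding norm_mult norm_of_real by (intro mult_left_le_one_le) auto
    then show "AE x in lborel. norm (exp (- (e n * x)\<^sup>2 / 2) * fourier_real b x) \<le> norm (fourier_real b x)" for n
      by auto
  qed (use F borel_measurable_integrable[OF F] in \<open>auto intro: integrable_norm\<close>)
  have 2: "(\<lambda>n. LINT r|lborel. (2 * pi) * (?N r * b (e n * r))) \<longlonglongrightarrow> (LINT r|lborel. (2 * pi) * (?N r * b 0))"
  proof (rule integral_dominated_convergence[where w="\<lambda>r. (2 * pi * C) * ?N r"])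
    show "AE x in lborel. (\<lambda>n. (2 * pi) * (?N x * b (e n * x))) \<longlonglongrightarrow> (2 * pi) * (?N x * b 0)"
    proof (intro AE_I2)
      fix x
      have "(\<lambda>n. b (e n * x)) \<longlonglongrightarrow> b (0 * x)"
        using cont by (intro isCont_tendsto_compose[of _ b] tendsto_intros elim)
          (auto simp: continuous_on_eq_continuous_at)
      then show "(\<lambda>n. (2 * pi) * (?N x * b (e n * x))) \<longlonglongrightarrow> (2 * pi) * (?N x * b 0)"
        by (intro tendsto_intros) auto
    qed
    have "norm ((2 * pi) * (?N x * b (e n * x))) \<le> (2 * pi * C) * ?N x" for n x
      using mult_left_mono[OF bd[of "e n * x"], of "?N x"] by (auto simp: abs_mult mult.commute)
    then show "AE x in lborel. norm ((2 * pi) * (?N x * b (e n * x))) \<le> (2 * pi * C) * ?N x" for n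
      by auto
  qed auto
  have "(LINT r|lborel. (2 * pi) * (?N r * b 0)) = 2 * pi * b 0"
    by simp
  then have "(\<lambda>n. complex_of_real (LINT r|lborel. (2 * pi) * (?N r * b (e n * r)))) \<longlonglongrightarrow> complex_of_real (2 * pi * b 0)"
    using 2 by (intro tendsto_of_real) simp
  from LIMSEQ_unique[OF 1[unfolded key[OF e]] this] show ?thesis .
qed

section \<open>An annihilating kernel\<close>

text \<open>Lebesgue measure on \<open>real^'n\<close> is the image under \<open>T\<close> of a
  product measure indexed by \<open>Basis\<close>, where Fubini for products applies. What remains
  is to pass from basis vectors to the coordinate indices in \<open>'n\<close>.\<close>

lemma
  fixes f :: "'n::finite \<Rightarrow> real \<Rightarrow> complex"
  assumes f: "\<And>i. integrable lborel (f i)"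
  shows integrable_lborel_prod_nth: "integrable lborel (\<lambda>x::real^'n. \<Prod>i\<in>UNIV. f i (x $ i))"
    and integral_lborel_prod_nth:
      "(LINT x|lborel. (\<Prod>i\<in>UNIV. f i ((x::real^'n) $ i))) = (\<Prod>i\<in>UNIV. (LINT t|lborel. f i t))"
proof -
  interpret product_sigma_finite "\<lambda>b::real^'n. lborel :: real measure" ..
  define T where "T = (\<lambda>x. \<Sum>b\<in>Basis. x b *\<^sub>R (b::real^'n))"
  define ax where "ax = (\<lambda>i::'n. axis i (1::real))"
  have inj: "inj ax" by (auto simp: inj_def ax_def axis_eq_axis)
  have Basis: "Basis = range ax"
    by (auto simp: Basis_vec_def ax_def)
  have Tnth: "T x $ i = x (ax i)" for x i
  proof -
    have "T x $ i = T x \<bullet> ax i" by (simp add: ax_def inner_axis)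
    also have "\<dots> = x (ax i)"
      unfolding T_def by (rule inner_sum_left_Basis) (simp add: Basis)
    finally show ?thesis .
  qed
  \<comment> \<open>\<open>inv ax\<close> reads the coordinate index off a basis vector.\<close>
  have reindex: "(\<Prod>b\<in>Basis. h (inv ax b) b) = (\<Prod>i\<in>UNIV. h i (ax i))" for h :: "'n \<Rightarrow> real^'n \<Rightarrow> complex"
    unfolding Basis by (subst prod.reindex[OF inj]) (simp add: inv_f_f[OF inj])
  have meas[measurable]: "f i \<in> borel_measurable borel" for i
    using borel_measurable_integrable[OF f[of i]] by simp
  have T[measurable]: "T \<in> measurable (\<Pi>\<^sub>M b\<in>Basis. lborel) borel"
    unfolding T_def by measurable
  have m: "(\<lambda>x::real^'n. \<Prod>i\<in>UNIV. f i (x $ i)) \<in> borel_measurable borel"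
    by measurable
  have 1: "(\<Prod>i\<in>UNIV. f i (T x $ i)) = (\<Prod>b\<in>Basis. f (inv ax b) (x b))" for x
    by (simp add: Tnth reindex[of "\<lambda>i b. f i (x b)"])
  show "integrable lborel (\<lambda>x::real^'n. \<Prod>i\<in>UNIV. f i (x $ i))"
    unfolding lborel_eq[where 'a="real^'n", folded T_def] integrable_distr_eq[OF T m] 1
    by (intro product_integrable_prod f) simp
  show "(LINT x|lborel. (\<Prod>i\<in>UNIV. f i ((x::real^'n) $ i))) = (\<Prod>i\<in>UNIV. (LINT t|lborel. f i t))"
    unfolding lborel_eq[where 'a="real^'n", folded T_def] integral_distr[OF T m] 1
    by (subst product_integral_prod) (auto simp: f reindex[of "\<lambda>i b. integral\<^sup>L lborel (f i)"])
qed

lemma bump_fourier_real: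
  assumes "\<delta> > 0"
  shows "integrable lborel (fourier_real (bump \<delta>))"
    and "(LINT t|lborel. fourier_real (bump \<delta>) t) = 2 * pi * bump \<delta> 0"
    and "integrable lborel (bump \<delta>)"
proof -
  let ?h = exp_flat_deriv
  note D = exp_flat_deriv_has_real_derivative
  have Dm: "((\<lambda>x. ?h j (\<delta> - x)) has_real_derivative - ?h (Suc j) (\<delta> - x)) (at x)" for j x
    by (rule DERIV_cong[OF DERIV_chain2[OF D]]) (auto intro!: derivative_eq_intros)
  have Dp: "((\<lambda>x. ?h j (\<delta> + x)) has_real_derivative ?h (Suc j) (\<delta> + x)) (at x)" for j x
    by (rule DERIV_cong[OF DERIV_chain2[OF D]]) (auto intro!: derivative_eq_intros)
  have ch: "continuous_on UNIV (?h j)" for j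
    using D by (meson DERIV_continuous_on has_field_derivative_at_within)
  have cc: "continuous_on UNIV (\<lambda>x. ?h j (\<delta> + x))" "continuous_on UNIV (\<lambda>x. ?h j (\<delta> - x))" for j
    by (auto intro!: continuous_intros continuous_on_compose2[OF ch])
  \<comment> \<open>The bump and both its derivatives are combinations of such products, so this one
    fact confines all three supports.\<close>
  have supp: "?h i (\<delta> + x) * ?h j (\<delta> - x) = 0" if "x \<notin> {-\<delta><..<\<delta>}" for x i j
    using that by (cases "x \<ge> 0") (auto simp: exp_flat_deriv_nonpos)
  define b1 where "b1 x = ?h 1 (\<delta> + x) * ?h 0 (\<delta> - x) - ?h 0 (\<delta> + x) * ?h 1 (\<delta> - x)" for x
  define b2 where "b2 x = ?h 2 (\<delta> + x) * ?h 0 (\<delta> - x) - 2 * (?h 1 (\<delta> + x) * ?h 1 (\<delta> - x))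
    + ?h 0 (\<delta> + x) * ?h 2 (\<delta> - x)" for x
  show F: "integrable lborel (fourier_real (bump \<delta>))"
  proof (rule fourier_real_integrable[where ?b1.0 = b1 and ?b2.0 = b2 and \<delta>=\<delta>])
    show "(bump \<delta> has_real_derivative b1 x) (at x)" for x
      unfolding bump_def[abs_def] b1_def
      by (rule DERIV_cong[OF DERIV_mult[OF Dp Dm]]) (simp add: algebra_simps)
    show "(b1 has_real_derivative b2 x) (at x)" for x
      unfolding b1_def[abs_def] b2_def
      by (rule DERIV_cong[OF DERIV_diff[OF DERIV_mult[OF Dp Dm] DERIV_mult[OF Dp Dm]]])
         (simp add: algebra_simps numeral_2_eq_2)
    show "continuous_on UNIV b2"
      unfolding b2_def[abs_def] by (intro continuous_intros cc)
    show "bump \<delta> x = 0" "b1 x = 0" "b2 x = 0" if "x \<notin> {-\<delta><..<\<delta>}" for x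
      by (simp_all add: bump_def b1_def b2_def supp[OF that] del: mult_eq_0_iff)
  qed (use assms in simp)
  have c: "continuous_on UNIV (bump \<delta>)"
    unfolding bump_def[abs_def] by (intro continuous_intros cc)
  show int: "integrable lborel (bump \<delta>)"
    by (rule continuous_compact_support_integrable_lborel[OF c, where a="-\<delta>" and b=\<delta>])
      (auto intro: bump_eq_0)
  have "compact (bump \<delta> ` {-\<delta>..\<delta>})"
    by (intro compact_continuous_image continuous_on_subset[OF c]) auto
  then obtain C where C: "\<And>x. x \<in> {-\<delta>..\<delta>} \<Longrightarrow> \<bar>bump \<delta> x\<bar> \<le> C"
    by (force dest!: compact_imp_bounded simp: bounded_iff)
  have "\<bar>bump \<delta> x\<bar> \<le> max C 0" for x
    using C[of x] bump_eq_0[of \<delta> x] by (cases "x \<in> {-\<delta>..\<delta>}") auto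
  from integral_fourier_real[OF int c this F]
  show "(LINT t|lborel. fourier_real (bump \<delta>) t) = 2 * pi * bump \<delta> 0" by simp
qed

lemma bump_tensor_measurable[measurable]: "bump_tensor \<delta> \<in> borel_measurable borel"
  using Ck_bump_tensor[of 0 \<delta>] by (auto intro: borel_measurable_continuous_onI)

text \<open>The character of an inner product is the product of the characters of the coordinates,
  so the whole integrand splits.\<close>

lemma fourier_bump_tensor:
  fixes x :: "real^'n"
  assumes "\<delta> > 0"
  shows "fourier (bump_tensor \<delta>) x = (\<Prod>i\<in>UNIV. fourier_real (bump \<delta>) (x $ i))"
proof -
  have int: "integrable lborel (\<lambda>s. exp (- \<i> * complex_of_real (s * t)) * complex_of_real (bump \<delta> s))" for t
    by (rule Bochner_Integration.integrable_bound[OF bump_fourier_real(3)[OF assms]])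
       (use borel_measurable_integrable[OF bump_fourier_real(3)[OF assms]] in \<open>auto simp: norm_mult\<close>)
  have "fourier (bump_tensor \<delta>) x = (LINT \<xi>|lborel. exp (- \<i> * complex_of_real (\<xi> \<bullet> x)) * bump_tensor \<delta> \<xi>)"
    unfolding fourier_def by (intro integral_completion) simp
  also have "\<dots> = (LINT \<xi>|lborel. (\<Prod>i\<in>UNIV. exp (- \<i> * complex_of_real (\<xi> $ i * x $ i)) * complex_of_real (bump \<delta> (\<xi> $ i))))"
    by (intro Bochner_Integration.integral_cong)
       (auto simp: bump_tensor_def inner_vec_def prod.distrib exp_sum sum_distrib_left sum_negf[symmetric])
  also have "\<dots> = (\<Prod>i\<in>UNIV. (LINT t|lborel. exp (- \<i> * complex_of_real (t * x $ i)) * complex_of_real (bump \<delta> t)))"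
    by (rule integral_lborel_prod_nth[OF int])
  finally show ?thesis by (simp add: fourier_real_def)
qed

text \<open>Fourier inversion at the origin, one coordinate at a time; \<open>bump_0_pos\<close>
  then makes the mass non-zero.\<close>

lemma fourier_bump_tensor_integrable:
  assumes "\<delta> > 0"
  shows "integrable lborel (fourier (bump_tensor \<delta> :: real^'n \<Rightarrow> complex))"
    and "(LINT x|lborel. fourier (bump_tensor \<delta>) (x::real^'n)) = (2 * pi * bump \<delta> 0) ^ CARD('n)"
  unfolding fourier_bump_tensor[OF assms, abs_def]
  using integrable_lborel_prod_nth[OF bump_fourier_real(1)[OF assms]]
    integral_lborel_prod_nth[OF bump_fourier_real(1)[OF assms]] bump_fourier_real(2)[OF assms]
  by simp_all

lemma fourier_modulate:
  "fourier (\<lambda>\<xi>. exp (- \<i> * complex_of_real (y \<bullet> \<xi>)) * \<phi> \<xi>) x = fourier \<phi> (x + y)"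
  unfolding fourier_def
  by (intro Bochner_Integration.integral_cong)
     (auto simp: inner_add_right inner_commute exp_add[symmetric] algebra_simps mult_exp_exp)

lemma integral_lborel_translate:
  fixes f :: "'a::euclidean_space \<Rightarrow> 'b::{banach, second_countable_topology}"
  assumes [measurable]: "f \<in> borel_measurable borel"
  shows "(LINT x|lborel. f (x + c)) = (LINT x|lborel. f x)"
proof -
  have "(LINT x|lborel. f x) = (LINT x|distr lborel borel ((+) c). f x)"
    by (simp add: lborel_distr_plus)
  also have "\<dots> = (LINT x|lborel. f (c + x))"
    by (rule integral_distr) auto
  finally show ?thesis by (simp add: add.commute)
qed

text \<open>A spectral gap at 0 yields a convolution kernel of non-zero mass that annihilates the function:
  the translates of the kernel are the transforms of the modulations of one test function.\<close>

lemma spectral_gap_imp_annihilating_kernel: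
  fixes g :: "real^'n \<Rightarrow> real"
  assumes g: "continuous_on UNIV g" and bd: "\<And>x. \<bar>g x\<bar> \<le> C"
    and gap: "0 \<notin> dist_supp (fourier_dist g)"
  obtains k where "integrable lborel k" "(LINT x|lborel. k x) \<noteq> 0"
    "\<And>z. (LINT x|lborel. k x * g (z + x)) = 0"
proof -
  obtain U where U: "open U" "0 \<in> U"
    "\<And>\<phi>. \<phi> \<in> test_functions \<Longrightarrow> fun_supp \<phi> \<subseteq> U \<Longrightarrow> fourier_dist g \<phi> = 0"
    using gap by (auto simp: dist_supp_def)
  then obtain r where r: "r > 0" "cball 0 r \<subseteq> U"
    using open_contains_cball by blast
  \<comment> \<open>The l1 estimate for the support loses a factor \<open>CARD('n)\<close>; dividing
    by it puts the support inside \<open>cball 0 r\<close>.\<close>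
  define \<delta> where "\<delta> = r / CARD('n)"
  have \<delta>: "\<delta> > 0" "CARD('n) * \<delta> = r"
    using r by (auto simp: \<delta>_def)
  define K :: "real^'n \<Rightarrow> complex" where "K = fourier (bump_tensor \<delta>)"
  have K: "integrable lborel K" "(LINT x|lborel. K x) = (2 * pi * bump \<delta> 0) ^ CARD('n)"
    using fourier_bump_tensor_integrable[OF \<delta>(1)] by (auto simp: K_def)
  have [measurable]: "K \<in> borel_measurable borel" "g \<in> borel_measurable borel"
    using K(1) g by (auto intro: borel_measurable_continuous_onI)
  have ann: "(LINT x|lborel. K x * complex_of_real (g (z + x))) = 0" for z
  proof -
    \<comment> \<open>Modulating by -z turns the transform into \<open>K (x - z)\<close>; moving the
      variable by z then shifts the translation onto \<open>g\<close>.\<close>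
    have "0 = fourier_dist g (\<lambda>\<xi>. exp (- \<i> * complex_of_real ((-z) \<bullet> \<xi>)) * bump_tensor \<delta> \<xi>)"
      using modulated_bump_tensor_test_function[of "-z" \<delta>] \<delta> r(2) by (subst U(3)) (auto simp: \<delta>)
    also have "\<dots> = (LINT x|lborel. complex_of_real (g x) * K (x + - z))"
      unfolding fourier_dist_def fourier_modulate K_def[symmetric]
      by (intro integral_completion) simp
    also have "\<dots> = (LINT x|lborel. complex_of_real (g ((x + z))) * K ((x + z) + - z))"
      by (rule integral_lborel_translate[symmetric]) simp
    finally show ?thesis by (simp add: ac_simps)
  qed
  \<comment> \<open>Real parts suffice: \<open>g\<close> is real, so annihilation survives, and the
    mass of \<open>K\<close> is a positive real number.\<close>
  show ?thesis
  proof (rule that[of "\<lambda>x. Re (K x)"])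
    show "integrable lborel (\<lambda>x. Re (K x))" using K by simp
    have "(LINT x|lborel. Re (K x)) = (2 * pi * bump \<delta> 0) ^ CARD('n)"
      using K by (simp flip: of_real_power of_real_mult)
    then show "(LINT x|lborel. Re (K x)) \<noteq> 0"
      using bump_0_pos[OF \<delta>(1)] by simp
    fix z
    have "integrable lborel (\<lambda>x. K x * complex_of_real (g (z + x)))"
    proof (rule Bochner_Integration.integrable_bound)
      show "integrable lborel (\<lambda>x. C * norm (K x))"
        using K by (intro integrable_mult_right integrable_norm)
      have "norm (K x * complex_of_real (g (z + x))) \<le> norm (C * norm (K x))" for x
        using mult_right_mono[OF bd[of "z + x"], of "norm (K x)"]
        by (auto simp: norm_mult mult.commute)
      then show "AE x in lborel. norm (K x * complex_of_real (g (z + x))) \<le> norm (C * norm (K x))" by simp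
    qed simp
    then have "(LINT x|lborel. Re (K x * complex_of_real (g (z + x)))) = 0"
      using ann[of z] by (simp only: integral_Re) simp
    then show "(LINT x|lborel. Re (K x) * g (z + x)) = 0" by simp
  qed
qed

section \<open>The mean value functional\<close>

lemma has_mean_value_unique:
  fixes g :: "real^'n \<Rightarrow> real"
  assumes "has_mean_value g m" "has_mean_value g m'"
  shows "m = m'"
proof -
  let ?B = "ball 0 1 :: (real^'n) set"
  have "bounded ?B \<and> ?B \<in> sets lebesgue" by simp
  then have "measure lebesgue ?B * m = measure lebesgue ?B * m'"
    using assms unfolding has_mean_value_def
    by (meson tendsto_unique trivial_limit_at_right_real)
  then show ?thesis by simp
qed

lemma translate_apply: "apply_bcontfun (translate y f) x = f (x + y)"
  by (simp add: translate.rep_eq)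

lemma bcf_mult_apply: "apply_bcontfun (bcf_mult f g) x = f x * g x"
  by (simp add: bcf_mult.rep_eq)

lemma bcontfun_measurable[measurable (raw)]:
  fixes f :: "'a::topological_space \<Rightarrow>\<^sub>C real"
  assumes "h \<in> measurable N borel"
  shows "(\<lambda>x. f (h x)) \<in> borel_measurable N"
  by (rule measurable_compose[OF assms]) (rule borel_measurable_continuous_onI, simp)

lemma bcf_mult_commute: "bcf_mult f g = bcf_mult g f"
  by (rule bcontfun_eqI) (simp add: bcf_mult_apply)

lemma translate_diff: "translate y (f - g) = translate y f - translate y g"
  by (rule bcontfun_eqI) (simp add: translate_apply)

lemma ball_measurable[measurable]: "ball (c::'a::metric_space) r \<in> sets borel"
  by simp

lemma abs_bcontfun_le: "\<bar>apply_bcontfun (f :: 'a::topological_space \<Rightarrow>\<^sub>C real) x\<bar> \<le> norm f"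
  using norm_bounded[of f x] by simp

lemma integrable_indicator_ball: "integrable lborel (indicat_real (ball (c::'a::euclidean_space) r))"
  using emeasure_lborel_ball_finite[of c r] by (intro integrable_real_indicator) auto

lemma integrable_indicator_ball_scaled:
  fixes f :: "(real^'n) \<Rightarrow>\<^sub>C real"
  shows "integrable lborel (\<lambda>x. indicat_real (ball 0 1) x * f (x /\<^sub>R \<epsilon>))"
proof (rule Bochner_Integration.integrable_bound)
  show "integrable lborel (\<lambda>x::real^'n. norm f * indicat_real (ball 0 1) x)"
    by (intro integrable_mult_right integrable_indicator_ball)
  show "AE x in lborel. norm (indicat_real (ball 0 1) x * f (x /\<^sub>R \<epsilon>)) \<le> norm (norm f * indicat_real (ball 0 1) x)"
    using abs_bcontfun_le[of f] by (auto simp: indicator_def)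
qed measurable

text \<open>The scaled integral of \<open>has_mean_value\<close> on one test set, not divided by the
  volume. Linearity, positivity and bounds are proved at each scale and then passed to the
  limit.\<close>

definition ball_integral :: "((real^'n) \<Rightarrow>\<^sub>C real) \<Rightarrow> real \<Rightarrow> real" where
  "ball_integral f \<epsilon> = (LINT x|lborel. indicat_real (ball 0 1) x * f (x /\<^sub>R \<epsilon>))"

lemma abs_ball_integral_le:
  "\<bar>ball_integral (f :: (real^'n) \<Rightarrow>\<^sub>C real) \<epsilon>\<bar> \<le> norm f * measure lborel (ball (0::real^'n) 1)"
proof -
  have "\<bar>ball_integral f \<epsilon>\<bar> \<le> (LINT x|lborel. norm f * indicat_real (ball 0 1) (x::real^'n))"
    unfolding ball_integral_def real_norm_def[symmetric]
  proof (rule Bochner_Integration.integral_norm_bound_integral)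
    show "integrable lborel (\<lambda>x::real^'n. norm f * indicat_real (ball 0 1) x)"
      by (intro integrable_mult_right integrable_indicator_ball)
    show "norm (indicat_real (ball 0 1) x * f (x /\<^sub>R \<epsilon>)) \<le> norm f * indicat_real (ball 0 1) x" for x
      using abs_bcontfun_le[of f] by (auto simp: indicator_def)
  qed (rule integrable_indicator_ball_scaled)
  then show ?thesis by simp
qed

lemma ball_integral_add: "ball_integral (f + g) \<epsilon> = ball_integral f \<epsilon> + ball_integral g \<epsilon>"
  unfolding ball_integral_def
  by (simp add: distrib_left integrable_indicator_ball_scaled)

lemma ball_integral_scaleR: "ball_integral (r *\<^sub>R f) \<epsilon> = r * ball_integral f \<epsilon>"
  unfolding ball_integral_def by (simp add: mult.left_commute)

lemma ball_integral_nonneg: "(\<And>x. 0 \<le> apply_bcontfun f x) \<Longrightarrow> 0 \<le> ball_integral f \<epsilon>"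
  unfolding ball_integral_def by (intro integral_nonneg_AE) auto

lemma ball_integral_const:
  "ball_integral (const_bcontfun c :: (real^'n) \<Rightarrow>\<^sub>C real) \<epsilon> = measure lborel (ball (0::real^'n) 1) * c"
  unfolding ball_integral_def by simp

text \<open>After rescaling, a translation by y moves the ball by only \<epsilon> y. The moved and
  the original ball differ inside a shell of radii
  \<open>1 \<plusminus> \<epsilon> * norm y\<close>, whose volume tends to 0.\<close>

lemma ball_integral_translate_tendsto:
  fixes f :: "(real^'n) \<Rightarrow>\<^sub>C real"
  shows "((\<lambda>\<epsilon>. ball_integral (translate y f) \<epsilon> - ball_integral f \<epsilon>) \<longlongrightarrow> 0) (at_right 0)"
proof (rule Lim_null_comparison)
  let ?V = "\<lambda>r. unit_ball_vol (real CARD('n)) * r ^ CARD('n)"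
  have "((\<lambda>\<epsilon>. norm f * (?V (1 + \<epsilon> * norm y) - ?V (1 - \<epsilon> * norm y))) \<longlongrightarrow>
      norm f * (?V (1 + 0 * norm y) - ?V (1 - 0 * norm y))) (at_right 0)"
    by (intro tendsto_intros)
  then show "((\<lambda>\<epsilon>. norm f * (?V (1 + \<epsilon> * norm y) - ?V (1 - \<epsilon> * norm y))) \<longlongrightarrow> 0) (at_right 0)"
    by simp
  have "((\<lambda>\<epsilon>. \<epsilon> * norm y) \<longlongrightarrow> 0 * norm y) (at_right 0)"
    by (intro tendsto_intros)
  \<comment> \<open>Keeps the inner radius of the shell positive, so that the volume formula for
    balls applies to it.\<close>
  then have ev: "eventually (\<lambda>\<epsilon>. \<epsilon> * norm y < 1) (at_right 0)"
    by (rule order_tendstoD) simp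
  have "eventually (\<lambda>\<epsilon>::real. \<epsilon> > 0) (at_right 0)"
    by (simp add: eventually_at_right_less)
  with ev show "eventually (\<lambda>\<epsilon>. norm (ball_integral (translate y f) \<epsilon> - ball_integral f \<epsilon>) \<le>
      norm f * (?V (1 + \<epsilon> * norm y) - ?V (1 - \<epsilon> * norm y))) (at_right 0)"
  proof eventually_elim
    fix \<epsilon> :: real assume e: "\<epsilon> * norm y < 1" "\<epsilon> > 0"
    \<comment> \<open>The displacement in the rescaled variable:
      \<open>x /\<^sub>R \<epsilon> + y\<close> is
      \<open>(x + w) /\<^sub>R \<epsilon>\<close>.\<close>
    define w where "w = \<epsilon> *\<^sub>R y"
    have w: "norm w = \<epsilon> * norm y" using e by (simp add: w_def)
    let ?I = "\<lambda>r. indicat_real (ball (0::real^'n) r)"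
    have intI: "integrable lborel (?I r)" for r
      by (rule integrable_indicator_ball)
    have "ball_integral (translate y f) \<epsilon> = (LINT x|lborel. ?I 1 ((x + w) - w) * f ((x + w) /\<^sub>R \<epsilon>))"
      using e unfolding ball_integral_def
      by (simp add: translate_apply w_def scaleR_add_right)
    also have "\<dots> = (LINT x|lborel. ?I 1 (x - w) * f (x /\<^sub>R \<epsilon>))"
      by (rule integral_lborel_translate[of "\<lambda>x. ?I 1 (x - w) * f (x /\<^sub>R \<epsilon>)"]) measurable
    finally have 1: "ball_integral (translate y f) \<epsilon> = (LINT x|lborel. ?I 1 (x - w) * f (x /\<^sub>R \<epsilon>))" .
    have "integrable lborel (\<lambda>x. ?I 1 (x - w) * f (x /\<^sub>R \<epsilon>))"
    proof (rule Bochner_Integration.integrable_bound[of _ "\<lambda>x. norm f * indicat_real (ball w 1) x"])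
      show "integrable lborel (\<lambda>x. norm f * indicat_real (ball w 1) x)"
        by (intro integrable_mult_right integrable_indicator_ball)
    qed (use abs_bcontfun_le[of f] in \<open>auto simp: indicator_def dist_norm norm_minus_commute\<close>)
    then have "ball_integral (translate y f) \<epsilon> - ball_integral f \<epsilon> =
      (LINT x|lborel. ?I 1 (x - w) * f (x /\<^sub>R \<epsilon>) - ?I 1 x * f (x /\<^sub>R \<epsilon>))"
      unfolding 1 unfolding ball_integral_def
      by (subst Bochner_Integration.integral_diff) (auto intro: integrable_indicator_ball_scaled)
    also have "norm \<dots> \<le> (LINT x|lborel. norm f * (?I (1 + norm w) x - ?I (1 - norm w) x))"
    proof (rule Bochner_Integration.integral_norm_bound_integral)
      show "integrable lborel (\<lambda>x. ?I 1 (x - w) * f (x /\<^sub>R \<epsilon>) - ?I 1 x * f (x /\<^sub>R \<epsilon>))"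
        by (intro Bochner_Integration.integrable_diff integrable_indicator_ball_scaled) fact
      show "integrable lborel (\<lambda>x. norm f * (?I (1 + norm w) x - ?I (1 - norm w) x))"
        by (intro Bochner_Integration.integrable_diff integrable_mult_right intI)
      fix x :: "real^'n"
      \<comment> \<open>A point lying in exactly one of the two balls has norm at least
        \<open>1 - norm w\<close> and below \<open>1 + norm w\<close>.\<close>
      have "\<bar>?I 1 (x - w) - ?I 1 x\<bar> \<le> ?I (1 + norm w) x - ?I (1 - norm w) x"
        using norm_triangle_ineq4[of x w] norm_triangle_ineq[of "x - w" w] norm_ge_zero[of w]
        by (auto simp: indicator_def)
      then have "\<bar>?I 1 (x - w) - ?I 1 x\<bar> * \<bar>f (x /\<^sub>R \<epsilon>)\<bar> \<le> (?I (1 + norm w) x - ?I (1 - norm w) x) * norm f"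
        by (intro mult_mono abs_bcontfun_le) auto
      then show "norm (?I 1 (x - w) * f (x /\<^sub>R \<epsilon>) - ?I 1 x * f (x /\<^sub>R \<epsilon>)) \<le> norm f * (?I (1 + norm w) x - ?I (1 - norm w) x)"
        by (simp add: abs_mult[symmetric] algebra_simps)
    qed
    also have "\<dots> = norm f * (?V (1 + norm w) - ?V (1 - norm w))"
      using e w by (simp add: intI content_ball)
    finally show "norm (ball_integral (translate y f) \<epsilon> - ball_integral f \<epsilon>) \<le>
      norm f * (?V (1 + \<epsilon> * norm y) - ?V (1 - \<epsilon> * norm y))"
      by (simp add: w)
  qed
qed

section \<open>The mean as a positive translation invariant functional on the algebra\<close>

locale mean_value_algebra =
  fixes A :: "((real^'n) \<Rightarrow>\<^sub>C real) set"
  assumes algebra: "algebra_with_mean_value A"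
begin

definition M :: "((real^'n) \<Rightarrow>\<^sub>C real) \<Rightarrow> real" where
  "M f = mean_value (apply_bcontfun f)"

lemma subspace_A: "subspace A"
  using algebra by (simp add: algebra_with_mean_value_def)

lemma mult_mem: "f \<in> A \<Longrightarrow> g \<in> A \<Longrightarrow> bcf_mult f g \<in> A"
  using algebra by (simp add: algebra_with_mean_value_def)

lemma translate_mem: "f \<in> A \<Longrightarrow> translate y f \<in> A"
  using algebra by (simp add: algebra_with_mean_value_def)

lemma const_mem: "const_bcontfun c \<in> A"
proof -
  have "c *\<^sub>R const_bcontfun 1 \<in> A"
    using algebra by (intro subspace_scale[OF subspace_A]) (simp add: algebra_with_mean_value_def)
  also have "c *\<^sub>R const_bcontfun 1 = const_bcontfun c"
    by (rule bcontfun_eqI) simp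
  finally show ?thesis .
qed

lemmas mem_intros = mult_mem translate_mem const_mem subspace_add[OF subspace_A]
  subspace_diff[OF subspace_A] subspace_scale[OF subspace_A] subspace_neg[OF subspace_A]

lemma has_mean_value_M: "f \<in> A \<Longrightarrow> has_mean_value f (M f)"
proof -
  assume "f \<in> A"
  then obtain m where m: "has_mean_value f m"
    using algebra by (auto simp: algebra_with_mean_value_def)
  then show ?thesis
    unfolding M_def mean_value_def by (rule theI) (rule has_mean_value_unique[OF _ m])
qed

lemma ball_integral_tendsto:
  assumes "f \<in> A"
  shows "(ball_integral f \<longlongrightarrow> measure lborel (ball (0::real^'n) 1) * M f) (at_right 0)"
proof -
  let ?B = "ball 0 1 :: (real^'n) set"
  have B: "bounded ?B \<and> ?B \<in> sets lebesgue" by simp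
  have "((\<lambda>\<epsilon>. set_lebesgue_integral lebesgue ?B (\<lambda>x. f (x /\<^sub>R \<epsilon>))) \<longlongrightarrow> measure lebesgue ?B * M f) (at_right 0)"
    using has_mean_value_M[OF assms] B unfolding has_mean_value_def by blast
  moreover have "set_lebesgue_integral lebesgue ?B (\<lambda>x. f (x /\<^sub>R \<epsilon>)) = ball_integral f \<epsilon>" for \<epsilon>
    unfolding set_lebesgue_integral_def ball_integral_def
    by (subst integral_completion) auto
  ultimately show ?thesis by simp
qed

text \<open>The route by which laws of \<open>ball_integral\<close> become laws of \<open>M\<close>:
  limits are unique and the positive volume of the ball cancels.\<close>

lemma M_eqI:
  assumes "f \<in> A" "(ball_integral f \<longlongrightarrow> measure lborel (ball (0::real^'n) 1) * m) (at_right 0)"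
  shows "M f = m"
  using tendsto_unique[OF _ ball_integral_tendsto[OF assms(1)] assms(2)] by simp

lemma M_add: "f \<in> A \<Longrightarrow> g \<in> A \<Longrightarrow> M (f + g) = M f + M g"
  using tendsto_add[OF ball_integral_tendsto ball_integral_tendsto]
  by (intro M_eqI mem_intros) (auto simp: ball_integral_add[abs_def] distrib_left)

lemma M_scaleR: "f \<in> A \<Longrightarrow> M (r *\<^sub>R f) = r * M f"
  using tendsto_mult[OF tendsto_const ball_integral_tendsto, of f r]
  by (intro M_eqI mem_intros) (auto simp: ball_integral_scaleR[abs_def] mult_ac)

lemma M_diff: "f \<in> A \<Longrightarrow> g \<in> A \<Longrightarrow> M (f - g) = M f - M g"
  using M_add[of f "(-1) *\<^sub>R g"] M_scaleR[of g "-1"] by (simp add: mem_intros)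

lemma M_const: "M (const_bcontfun c) = c"
  by (intro M_eqI mem_intros) (simp add: ball_integral_const[abs_def])

lemma M_nonneg: "f \<in> A \<Longrightarrow> (\<And>x. 0 \<le> apply_bcontfun f x) \<Longrightarrow> 0 \<le> M f"
proof -
  assume "f \<in> A" "\<And>x. 0 \<le> apply_bcontfun f x"
  then have "0 \<le> measure lborel (ball (0::real^'n) 1) * M f"
    by (intro tendsto_lowerbound[OF ball_integral_tendsto]) (auto simp: ball_integral_nonneg)
  moreover have "0 < measure lborel (ball (0::real^'n) 1)" by simp
  ultimately show ?thesis by (metis zero_le_mult_iff not_less)
qed

lemma abs_M_le: "f \<in> A \<Longrightarrow> \<bar>M f\<bar> \<le> norm f"
proof -
  assume f: "f \<in> A"
  have "\<bar>measure lborel (ball (0::real^'n) 1) * M f\<bar> \<le> norm f * measure lborel (ball (0::real^'n) 1)"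
    by (rule tendsto_upperbound[OF tendsto_rabs[OF ball_integral_tendsto[OF f]]])
       (auto simp: abs_ball_integral_le)
  then show ?thesis by (simp add: abs_mult)
qed

lemma M_translate: "f \<in> A \<Longrightarrow> M (translate y f) = M f"
  using tendsto_add[OF ball_integral_translate_tendsto ball_integral_tendsto, of f y f]
  by (intro M_eqI mem_intros) auto

section \<open>The semi-inner product given by the mean, and its seminorm\<close>

definition ip :: "((real^'n) \<Rightarrow>\<^sub>C real) \<Rightarrow> ((real^'n) \<Rightarrow>\<^sub>C real) \<Rightarrow> real" where
  "ip f g = M (bcf_mult f g)"

lemma ip_commute: "ip f g = ip g f"
  by (simp add: ip_def bcf_mult_commute)

lemma ip_add_left: "f \<in> A \<Longrightarrow> g \<in> A \<Longrightarrow> h \<in> A \<Longrightarrow> ip (f + g) h = ip f h + ip g h"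
proof -
  have "bcf_mult (f + g) h = bcf_mult f h + bcf_mult g h"
    by (rule bcontfun_eqI) (simp add: bcf_mult_apply algebra_simps)
  then show "f \<in> A \<Longrightarrow> g \<in> A \<Longrightarrow> h \<in> A \<Longrightarrow> ?thesis"
    by (simp add: ip_def M_add mem_intros)
qed

lemma ip_scaleR_left: "f \<in> A \<Longrightarrow> h \<in> A \<Longrightarrow> ip (r *\<^sub>R f) h = r * ip f h"
proof -
  have "bcf_mult (r *\<^sub>R f) h = r *\<^sub>R bcf_mult f h"
    by (rule bcontfun_eqI) (simp add: bcf_mult_apply)
  then show "f \<in> A \<Longrightarrow> h \<in> A \<Longrightarrow> ?thesis"
    by (simp add: ip_def M_scaleR mem_intros)
qed

lemma ip_add_right: "f \<in> A \<Longrightarrow> g \<in> A \<Longrightarrow> h \<in> A \<Longrightarrow> ip h (f + g) = ip h f + ip h g"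
  using ip_add_left[of f g h] by (simp add: ip_commute)

lemma ip_scaleR_right: "f \<in> A \<Longrightarrow> h \<in> A \<Longrightarrow> ip h (r *\<^sub>R f) = r * ip h f"
  using ip_scaleR_left[of f h r] by (simp add: ip_commute)

lemma ip_diff_left: "f \<in> A \<Longrightarrow> g \<in> A \<Longrightarrow> h \<in> A \<Longrightarrow> ip (f - g) h = ip f h - ip g h"
  using ip_add_left[of f "(-1) *\<^sub>R g" h] ip_scaleR_left[of g h "-1"] by (simp add: mem_intros)

lemma ip_diff_right: "f \<in> A \<Longrightarrow> g \<in> A \<Longrightarrow> h \<in> A \<Longrightarrow> ip h (f - g) = ip h f - ip h g"
  using ip_diff_left[of f g h] by (simp add: ip_commute)

lemma ip_const_right: "f \<in> A \<Longrightarrow> ip f (const_bcontfun c) = c * M f"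
proof -
  have "bcf_mult f (const_bcontfun c) = c *\<^sub>R f"
    by (rule bcontfun_eqI) (simp add: bcf_mult_apply)
  then show "f \<in> A \<Longrightarrow> ?thesis"
    by (simp add: ip_def M_scaleR)
qed

lemma ip_translate: "f \<in> A \<Longrightarrow> g \<in> A \<Longrightarrow> ip (translate y f) (translate y g) = ip f g"
proof -
  have "bcf_mult (translate y f) (translate y g) = translate y (bcf_mult f g)"
    by (rule bcontfun_eqI) (simp add: bcf_mult_apply translate_apply)
  then show "f \<in> A \<Longrightarrow> g \<in> A \<Longrightarrow> ?thesis"
    by (simp add: ip_def M_translate mem_intros)
qed

lemma ip_self_nonneg: "f \<in> A \<Longrightarrow> 0 \<le> ip f f"
  unfolding ip_def by (intro M_nonneg mem_intros) (auto simp: bcf_mult_apply)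

text \<open>The discriminant argument for Cauchy-Schwarz. The form is only semidefinite, so a
  vanishing leading coefficient gets its own case.\<close>

lemma ip_square_le:
  assumes f: "f \<in> A" and g: "g \<in> A"
  shows "(ip f g)\<^sup>2 \<le> ip f f * ip g g"
proof -
  have q: "0 \<le> ip f f + 2 * t * ip f g + t\<^sup>2 * ip g g" for t
  proof -
    have "ip (f + t *\<^sub>R g) (f + t *\<^sub>R g) = ip f f + 2 * t * ip f g + t\<^sup>2 * ip g g"
      using f g
      by (simp add: ip_add_left ip_add_right mem_intros ip_scaleR_left ip_scaleR_right
          ip_commute[of g f] power2_eq_square algebra_simps)
    then show ?thesis using ip_self_nonneg[of "f + t *\<^sub>R g"] f g by (simp add: mem_intros)
  qed
  show ?thesis
  proof (cases "ip g g = 0")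
    case True
    have "ip f g = 0"
    proof (rule ccontr)
      assume nz: "ip f g \<noteq> 0"
      \<comment> \<open>With \<open>ip g g = 0\<close> the quadratic is affine in t; this t gives it
        the value -1.\<close>
      then have "2 * (- (ip f f + 1) / (2 * ip f g)) * ip f g = - (ip f f + 1)" by simp
      with q[of "- (ip f f + 1) / (2 * ip f g)"] True show False by simp
    qed
    then show ?thesis using True by simp
  next
    case False
    then have "ip g g > 0" using ip_self_nonneg[OF g] by simp
    \<comment> \<open>The minimiser of the quadratic in t.\<close>
    then show ?thesis
      using q[of "- ip f g / ip g g"] by (simp add: field_simps power2_eq_square)
  qed
qed

lemma mean_sq_eq: "mean_sq f = ip f f"
proof -
  have "(\<lambda>x. \<bar>apply_bcontfun f x\<bar>\<^sup>2) = apply_bcontfun (bcf_mult f f)"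
    by (auto simp: bcf_mult_apply power2_eq_square)
  then show ?thesis by (simp add: mean_sq_def ip_def M_def)
qed

abbreviation nrm :: "((real^'n) \<Rightarrow>\<^sub>C real) \<Rightarrow> real" where "nrm \<equiv> b2_seminorm"

lemma nrm_eq: "nrm f = sqrt (ip f f)"
  by (simp add: b2_seminorm_def mean_sq_eq)

lemma nrm_nonneg: "f \<in> A \<Longrightarrow> 0 \<le> nrm f"
  by (simp add: nrm_eq ip_self_nonneg)

lemma nrm_square: "f \<in> A \<Longrightarrow> (nrm f)\<^sup>2 = ip f f"
  by (simp add: nrm_eq ip_self_nonneg)

lemma abs_ip_le: "f \<in> A \<Longrightarrow> g \<in> A \<Longrightarrow> \<bar>ip f g\<bar> \<le> nrm f * nrm g"
  unfolding nrm_eq real_sqrt_mult[symmetric]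
  by (rule real_le_rsqrt) (simp add: ip_square_le)

lemma nrm_add_le:
  assumes "f \<in> A" "g \<in> A"
  shows "nrm (f + g) \<le> nrm f + nrm g"
proof (rule power2_le_imp_le)
  have "(nrm (f + g))\<^sup>2 = ip f f + 2 * ip f g + ip g g"
    using assms by (simp add: nrm_square mem_intros ip_add_left ip_add_right ip_commute[of g f])
  also have "\<dots> \<le> (nrm f + nrm g)\<^sup>2"
    using abs_ip_le[OF assms] by (simp add: power2_sum nrm_square assms)
  finally show "(nrm (f + g))\<^sup>2 \<le> (nrm f + nrm g)\<^sup>2" .
qed (use assms in \<open>simp add: nrm_nonneg\<close>)

lemma nrm_minus_commute: "f \<in> A \<Longrightarrow> g \<in> A \<Longrightarrow> nrm (f - g) = nrm (g - f)"
proof -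
  have "bcf_mult (f - g) (f - g) = bcf_mult (g - f) (g - f)"
    by (rule bcontfun_eqI) (simp add: bcf_mult_apply algebra_simps)
  then show ?thesis by (simp add: nrm_eq ip_def)
qed

lemma nrm_triangle: "f \<in> A \<Longrightarrow> g \<in> A \<Longrightarrow> h \<in> A \<Longrightarrow> nrm (f - h) \<le> nrm (f - g) + nrm (g - h)"
  using nrm_add_le[of "f - g" "g - h"] by (simp add: mem_intros)

lemma abs_nrm_diff_le: "f \<in> A \<Longrightarrow> g \<in> A \<Longrightarrow> \<bar>nrm f - nrm g\<bar> \<le> nrm (f - g)"
  using nrm_add_le[of "f - g" g] nrm_add_le[of "g - f" f] nrm_minus_commute[of f g]
  by (simp add: mem_intros abs_le_iff)

lemma nrm_diff_diff_le:
  assumes "f \<in> A" "g \<in> A" "f' \<in> A" "g' \<in> A"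
  shows "nrm ((f - g) - (f' - g')) \<le> nrm (f - f') + nrm (g - g')"
proof -
  have "(f - g) - (f' - g') = (f - f') + (g' - g)" by simp
  with nrm_add_le[of "f - f'" "g' - g"] nrm_minus_commute[of g g'] assms show ?thesis
    by (simp only: mem_intros)
qed

lemma nrm_translate_diff: "f \<in> A \<Longrightarrow> g \<in> A \<Longrightarrow> nrm (translate y f - translate y g) = nrm (f - g)"
  by (simp add: translate_diff[symmetric] nrm_eq ip_translate mem_intros)

text \<open>Turns uniform approximation, which is what regularity provides, into approximation in
  the seminorm.\<close>

lemma nrm_le_norm:
  assumes "f \<in> A"
  shows "nrm f \<le> norm f"
proof -
  have "norm (bcf_mult f f) \<le> norm f * norm f"
    using abs_bcontfun_le[of f]
    by (intro norm_bound) (auto simp: bcf_mult_apply abs_mult simp del: abs_mult_self_eq intro!: mult_mono)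
  then have "ip f f \<le> (norm f)\<^sup>2"
    using abs_M_le[OF mult_mem[OF assms assms]] by (simp add: ip_def power2_eq_square)
  then show ?thesis by (simp add: nrm_eq real_le_lsqrt)
qed

lemma nrm_const: "nrm (const_bcontfun c) = \<bar>c\<bar>"
  by (simp add: nrm_eq ip_const_right mem_intros M_const)

text \<open>Cauchy-Schwarz against the constant 1. It controls the change of the means along a
  Cauchy sequence in \<open>variance_tendsto_0\<close>.\<close>

lemma abs_M_le_nrm: "f \<in> A \<Longrightarrow> \<bar>M f\<bar> \<le> nrm f"
  using abs_ip_le[of f "const_bcontfun 1"] by (simp add: ip_const_right mem_intros nrm_const)

end

section \<open>The completion and ergodicity\<close>

context mean_value_algebra
begin

lemma b2_cauchy_mem: "u \<in> b2_cauchy A \<Longrightarrow> u k \<in> A"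
  by (simp add: b2_cauchy_def)

lemma b2_cauchyD:
  "u \<in> b2_cauchy A \<Longrightarrow> e > 0 \<Longrightarrow> \<exists>N. \<forall>j\<ge>N. \<forall>k\<ge>N. nrm (u j - u k) < e"
  by (simp add: b2_cauchy_def)

text \<open>A real quantity that is Lipschitz in the seminorm has a limit along \<open>u\<close>;
  used for the seminorm itself and for \<open>ip _ g\<close>, whose limit is the functional
  L.\<close>

lemma convergent_of_b2_cauchy:
  fixes \<psi> :: "nat \<Rightarrow> real"
  assumes u: "u \<in> b2_cauchy A" and "C \<ge> 0"
    and le: "\<And>j k. \<bar>\<psi> j - \<psi> k\<bar> \<le> C * nrm (u j - u k)"
  shows "convergent \<psi>"
proof (rule Cauchy_convergent, rule metric_CauchyI)
  fix e :: real assume "e > 0"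
  \<comment> \<open>Dividing by \<open>C + 1\<close> covers \<open>C = 0\<close>, which occurs when
    \<open>C\<close> is \<open>nrm g\<close> with \<open>g\<close> of seminorm 0.\<close>
  then have "e / (C + 1) > 0" using \<open>C \<ge> 0\<close> by simp
  from b2_cauchyD[OF u this] obtain N where N: "\<And>j k. j \<ge> N \<Longrightarrow> k \<ge> N \<Longrightarrow> nrm (u j - u k) < e / (C + 1)"
    by auto
  have "dist (\<psi> j) (\<psi> k) < e" if "j \<ge> N" "k \<ge> N" for j k
  proof -
    have "\<bar>\<psi> j - \<psi> k\<bar> \<le> C * nrm (u j - u k)" by (rule le)
    also have "\<dots> \<le> C * (e / (C + 1))"
      using N[OF that] \<open>C \<ge> 0\<close> by (intro mult_left_mono) auto
    also have "\<dots> < e"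
      using \<open>C \<ge> 0\<close> \<open>e > 0\<close> by (simp add: field_simps)
    finally show ?thesis by (simp add: dist_real_def)
  qed
  then show "\<exists>N. \<forall>m\<ge>N. \<forall>n\<ge>N. dist (\<psi> m) (\<psi> n) < e" by blast
qed

lemma nrm_b2_cauchy_convergent: "u \<in> b2_cauchy A \<Longrightarrow> convergent (\<lambda>k. nrm (u k))"
  by (rule convergent_of_b2_cauchy[where u=u and C=1]) (auto simp: abs_nrm_diff_le b2_cauchy_mem)

lemma ip_b2_cauchy_convergent:
  assumes u: "u \<in> b2_cauchy A" and g: "g \<in> A"
  shows "convergent (\<lambda>k. ip (u k) g)"
proof (rule convergent_of_b2_cauchy[where u=u and C="nrm g"])
  fix j k
  show "\<bar>ip (u j) g - ip (u k) g\<bar> \<le> nrm g * nrm (u j - u k)"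
    using abs_ip_le[of "u j - u k" g] b2_cauchy_mem[OF u] g
    by (simp add: ip_diff_left mem_intros mult.commute)
qed (use assms nrm_nonneg in auto)

lemma b2_cauchyI:
  assumes u: "u \<in> b2_cauchy A" and w: "\<And>k. w k \<in> A" and "C > 0"
    and le: "\<And>j k. nrm (w j - w k) \<le> C * nrm (u j - u k)"
  shows "w \<in> b2_cauchy A"
  unfolding b2_cauchy_def
proof (intro CollectI conjI allI impI w)
  fix e :: real assume "e > 0"
  then have "e / C > 0" using \<open>C > 0\<close> by simp
  from b2_cauchyD[OF u this] obtain N where N: "\<And>j k. j \<ge> N \<Longrightarrow> k \<ge> N \<Longrightarrow> nrm (u j - u k) < e / C"
    by auto
  have "nrm (w j - w k) < e" if "j \<ge> N" "k \<ge> N" for j k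
    using le[of j k] N[OF that] \<open>C > 0\<close> by (simp add: field_simps)
  then show "\<exists>N. \<forall>j\<ge>N. \<forall>k\<ge>N. nrm (w j - w k) < e" by blast
qed

lemma equiv_b2_rel: "equiv (b2_cauchy A) (b2_rel A)"
proof (rule equivI)
  show "b2_rel A \<subseteq> b2_cauchy A \<times> b2_cauchy A"
    by (auto simp: b2_rel_def)
  have "nrm (0 :: (real^'n) \<Rightarrow>\<^sub>C real) = 0"
    using nrm_const[of 0] by simp
  then show "refl_on (b2_cauchy A) (b2_rel A)"
    by (auto simp: refl_on_def b2_rel_def)
  show "sym (b2_rel A)"
    by (auto simp: sym_def b2_rel_def nrm_minus_commute[OF b2_cauchy_mem b2_cauchy_mem])
  show "trans (b2_rel A)"
  proof (rule transI)
    fix u v w assume uv: "(u, v) \<in> b2_rel A" and vw: "(v, w) \<in> b2_rel A"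
    then have mem: "u k \<in> A" "v k \<in> A" "w k \<in> A" for k
      by (auto simp: b2_rel_def b2_cauchy_mem)
    have "(\<lambda>k. nrm (u k - w k)) \<longlonglongrightarrow> 0"
    proof (rule tendsto_sandwich[OF _ _ tendsto_const])
      show "(\<lambda>k. nrm (u k - v k) + nrm (v k - w k)) \<longlonglongrightarrow> 0"
        using uv vw tendsto_add_zero by (auto simp: b2_rel_def)
    qed (auto intro!: always_eventually nrm_nonneg nrm_triangle mem_intros mem)
    then show "(u, w) \<in> b2_rel A"
      using uv vw by (auto simp: b2_rel_def)
  qed
qed

section \<open>Translation, difference and mean square on classes\<close>

lemma translate_b2_cauchy: "u \<in> b2_cauchy A \<Longrightarrow> (\<lambda>k. translate y (u k)) \<in> b2_cauchy A"
  by (rule b2_cauchyI[where u=u and C=1]) (auto simp: nrm_translate_diff b2_cauchy_mem mem_intros)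

lemma diff_b2_cauchy:
  assumes u: "u \<in> b2_cauchy A" and v: "v \<in> b2_cauchy A"
  shows "(\<lambda>k. u k - v k) \<in> b2_cauchy A"
  unfolding b2_cauchy_def
proof (intro CollectI conjI allI impI)
  show "u k - v k \<in> A" for k using u v by (auto intro: mem_intros b2_cauchy_mem)
  fix e :: real assume "e > 0"
  then obtain N N' where N: "\<And>j k. j \<ge> N \<Longrightarrow> k \<ge> N \<Longrightarrow> nrm (u j - u k) < e / 2"
    and N': "\<And>j k. j \<ge> N' \<Longrightarrow> k \<ge> N' \<Longrightarrow> nrm (v j - v k) < e / 2"
    using b2_cauchyD[OF u half_gt_zero] b2_cauchyD[OF v half_gt_zero] by metis
  have "nrm (u j - v j - (u k - v k)) < e" if "j \<ge> max N N'" "k \<ge> max N N'" for j k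
    using nrm_diff_diff_le[of "u j" "v j" "u k" "v k"] N[of j k] N'[of j k] that u v
    by (simp add: b2_cauchy_mem)
  then show "\<exists>N. \<forall>j\<ge>N. \<forall>k\<ge>N. nrm (u j - v j - (u k - v k)) < e" by blast
qed

text \<open>The union defining \<open>b2_translate\<close> runs over all representatives; invariance
  of the seminorm under translation makes them all yield the same class.\<close>

lemma b2_translate_class:
  assumes u: "u \<in> b2_cauchy A"
  shows "b2_translate A y (b2_rel A `` {u}) = b2_rel A `` {\<lambda>k. translate y (u k)}"
  unfolding b2_translate_def
proof (rule UN_equiv_class[OF equiv_b2_rel _ u], rule congruentI)
  fix v w assume vw: "(v, w) \<in> b2_rel A"
  then have "(\<lambda>k. translate y (v k), \<lambda>k. translate y (w k)) \<in> b2_rel A"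
    by (auto simp: b2_rel_def translate_b2_cauchy nrm_translate_diff b2_cauchy_mem)
  then show "b2_rel A `` {\<lambda>k. translate y (v k)} = b2_rel A `` {\<lambda>k. translate y (w k)}"
    by (rule equiv_class_eq[OF equiv_b2_rel])
qed

lemma b2_diff_class:
  assumes u: "u \<in> b2_cauchy A" and v: "v \<in> b2_cauchy A"
  shows "b2_diff A (b2_rel A `` {u}) (b2_rel A `` {v}) = b2_rel A `` {\<lambda>k. u k - v k}"
  unfolding b2_diff_def
proof (rule UN_equiv_class2[OF equiv_b2_rel equiv_b2_rel _ u v])
  show "congruent2 (b2_rel A) (b2_rel A) (\<lambda>u v. b2_rel A `` {\<lambda>k. u k - v k})"
  proof (rule congruent2I')
    fix u u' v v' assume uu: "(u, u') \<in> b2_rel A" and vv: "(v, v') \<in> b2_rel A"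
    then have mem: "u k \<in> A" "v k \<in> A" "u' k \<in> A" "v' k \<in> A" for k
      by (auto simp: b2_rel_def b2_cauchy_mem)
    have "(\<lambda>k. nrm ((u k - v k) - (u' k - v' k))) \<longlonglongrightarrow> 0"
    proof (rule tendsto_sandwich[OF _ _ tendsto_const])
      show "(\<lambda>k. nrm (u k - u' k) + nrm (v k - v' k)) \<longlonglongrightarrow> 0"
        using uu vv tendsto_add_zero by (auto simp: b2_rel_def)
    qed (auto intro!: always_eventually nrm_nonneg nrm_diff_diff_le mem_intros mem)
    then have "(\<lambda>k. u k - v k, \<lambda>k. u' k - v' k) \<in> b2_rel A"
      using uu vv by (auto simp: b2_rel_def diff_b2_cauchy)
    then show "b2_rel A `` {\<lambda>k. u k - v k} = b2_rel A `` {\<lambda>k. u' k - v' k}"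
      by (rule equiv_class_eq[OF equiv_b2_rel])
  qed
qed

text \<open>By the reverse triangle inequality all representatives share the limit of the seminorms,
  so the definite description in \<open>b2_mean_sq\<close> denotes its square.\<close>

lemma b2_mean_sq_class_tendsto:
  assumes w: "w \<in> b2_cauchy A"
  shows "(\<lambda>k. mean_sq (w k)) \<longlonglongrightarrow> b2_mean_sq (b2_rel A `` {w})"
proof -
  obtain l where l: "(\<lambda>k. nrm (w k)) \<longlonglongrightarrow> l"
    using nrm_b2_cauchy_convergent[OF w] by (auto simp: convergent_def)
  have msq: "(\<lambda>k. mean_sq (v k)) = (\<lambda>k. (nrm (v k))\<^sup>2)" if "v \<in> b2_cauchy A" for v
    using b2_cauchy_mem[OF that] by (simp add: nrm_square mean_sq_eq)
  have lim: "(\<lambda>k. mean_sq (v k)) \<longlonglongrightarrow> l\<^sup>2" if v: "v \<in> b2_rel A `` {w}" for v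
  proof -
    have vc: "v \<in> b2_cauchy A" and vw: "(\<lambda>k. nrm (w k - v k)) \<longlonglongrightarrow> 0"
      using v by (auto simp: b2_rel_def)
    have "(\<lambda>k. nrm (w k) - nrm (v k)) \<longlonglongrightarrow> 0"
      by (rule Lim_null_comparison[OF _ vw])
         (auto intro!: always_eventually abs_nrm_diff_le b2_cauchy_mem[OF w] b2_cauchy_mem[OF vc])
    from tendsto_diff[OF l this] have "(\<lambda>k. nrm (v k)) \<longlonglongrightarrow> l" by simp
    then show ?thesis unfolding msq[OF vc] by (rule tendsto_power)
  qed
  have ww: "w \<in> b2_rel A `` {w}"
    using equiv_class_self[OF equiv_b2_rel w] .
  have "b2_mean_sq (b2_rel A `` {w}) = l\<^sup>2"
    unfolding b2_mean_sq_def
    by (rule the_equality) (use lim ww LIMSEQ_unique in blast)+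
  then show ?thesis using lim[OF ww] by simp
qed

text \<open>At each scale, Fubini moves the y-integral inside, where \<open>ann\<close> makes it
  vanish; dominated convergence in the scale then reaches the mean. Measurability in y is likewise
  inherited from the scales.\<close>

lemma
  fixes k :: "real^'n \<Rightarrow> real"
  assumes f: "f \<in> A" and g: "g \<in> A" and k: "integrable lborel k"
    and ann: "\<And>z. (LINT x|lborel. k x * g (z + x)) = 0"
  shows ip_translate_measurable: "(\<lambda>y. k y * ip f (translate y g)) \<in> borel_measurable lborel"
    and integral_kernel_ip_translate: "(LINT y|lborel. k y * ip f (translate y g)) = 0"
proof -
  let ?B = "ball (0::real^'n) 1"
  let ?c = "measure lborel ?B"
  have c: "?c > 0" by simp
  have [measurable]: "k \<in> borel_measurable borel" using k by auto
  define e where "e = (\<lambda>n. 1 / real (Suc n))"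
  have e: "filterlim e (at_right 0) sequentially"
    unfolding filterlim_at
    using LIMSEQ_Suc[OF lim_1_over_n] by (auto simp: e_def intro!: always_eventually)
  let ?s = "\<lambda>n y. k y * ball_integral (bcf_mult f (translate y g)) (e n)"
  have s_eq: "?s n y = (LINT x|lborel. k y * (indicat_real ?B x * (f (x /\<^sub>R e n) * g (x /\<^sub>R e n + y))))" for n y
    by (simp add: ball_integral_def bcf_mult_apply translate_apply)
  have s[measurable]: "?s n \<in> borel_measurable lborel" for n
    unfolding s_eq[abs_def] by measurable
  have lim: "(\<lambda>n. ?s n y) \<longlonglongrightarrow> k y * (?c * ip f (translate y g))" for y
    unfolding ip_def
    by (intro tendsto_mult tendsto_const filterlim_compose[OF ball_integral_tendsto e] mem_intros f g)
  have meas: "(\<lambda>y. k y * (?c * ip f (translate y g))) \<in> borel_measurable lborel"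
    by (rule borel_measurable_LIMSEQ_real[OF lim s])
  \<comment> \<open>The limit still carries the volume \<open>?c\<close>, since
    \<open>ball_integral\<close> is not normalised.\<close>
  have "(\<lambda>y. inverse ?c * (k y * (?c * ip f (translate y g)))) \<in> borel_measurable lborel"
    using meas by measurable
  then show "(\<lambda>y. k y * ip f (translate y g)) \<in> borel_measurable lborel"
    using c by (simp add: field_simps)
  have s0: "(LINT y|lborel. ?s n y) = 0" for n
  proof -
    let ?h = "\<lambda>y x. k y * (indicat_real ?B x * (f (x /\<^sub>R e n) * g (x /\<^sub>R e n + y)))"
    have "integrable (lborel \<Otimes>\<^sub>M lborel) (\<lambda>(y, x). k y * (norm f * norm g * indicat_real ?B x))"
      by (intro integrable_pair_mult lborel_pair.pair_sigma_finite_axioms k integrable_mult_right integrable_indicator_ball)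
    then have "integrable (lborel \<Otimes>\<^sub>M lborel) (\<lambda>(y, x). ?h y x)"
    proof (rule Bochner_Integration.integrable_bound)
      have "norm (?h y x) \<le> norm (k y * (norm f * norm g * indicat_real ?B x))" for y x
        using mult_mono[OF abs_bcontfun_le[of f "x /\<^sub>R e n"] abs_bcontfun_le[of g "x /\<^sub>R e n + y"]]
        by (auto simp: abs_mult indicator_def intro!: mult_left_mono)
      then show "AE p in lborel \<Otimes>\<^sub>M lborel. norm (case p of (y, x) \<Rightarrow> ?h y x) \<le>
          norm (case p of (y, x) \<Rightarrow> k y * (norm f * norm g * indicat_real ?B x))"
        by auto
    qed measurable
    from lborel_pair.Fubini_integral[OF this]
    have "(LINT y|lborel. ?s n y) = (LINT x|lborel. LINT y|lborel. ?h y x)"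
      unfolding s_eq by simp
    \<comment> \<open>The inner integral is now \<open>ann\<close> at
      \<open>z = x /\<^sub>R e n\<close>.\<close>
    also have "\<dots> = (LINT x|lborel. (indicat_real ?B x * f (x /\<^sub>R e n)) * (LINT y|lborel. k y * g (x /\<^sub>R e n + y)))"
      by (subst integral_mult_right_zero[symmetric]) (simp add: mult_ac)
    finally show ?thesis by (simp add: ann)
  qed
  have "(\<lambda>n. LINT y|lborel. ?s n y) \<longlonglongrightarrow> (LINT y|lborel. k y * (?c * ip f (translate y g)))"
  proof (rule integral_dominated_convergence[where w="\<lambda>y. (norm f * norm g * ?c) * \<bar>k y\<bar>"])
    show "integrable lborel (\<lambda>y. (norm f * norm g * ?c) * \<bar>k y\<bar>)"
      using k by (intro integrable_mult_right integrable_abs)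
    have nb: "norm (bcf_mult f (translate y g)) \<le> norm f * norm g" for y
      by (rule norm_bound) (auto simp: bcf_mult_apply translate_apply abs_mult intro!: mult_mono abs_bcontfun_le)
    have "norm (?s n y) \<le> (norm f * norm g * ?c) * \<bar>k y\<bar>" for n y
    proof -
      have "\<bar>ball_integral (bcf_mult f (translate y g)) (e n)\<bar> \<le> norm f * norm g * ?c"
        by (rule order_trans[OF abs_ball_integral_le]) (intro mult_right_mono nb measure_nonneg)
      from mult_left_mono[OF this abs_ge_zero[of "k y"]]
      show ?thesis by (simp add: abs_mult mult_ac)
    qed
    then show "AE y in lborel. norm (?s n y) \<le> (norm f * norm g * ?c) * \<bar>k y\<bar>" for n
      by simp
  qed (use lim s meas in auto)
  then have "(LINT y|lborel. k y * (?c * ip f (translate y g))) = 0"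
    unfolding s0 by (simp add: LIMSEQ_const_iff)
  then show "(LINT y|lborel. k y * ip f (translate y g)) = 0"
    using c by (simp add: mult.left_commute[of _ ?c])
qed

text \<open>\<open>g \<mapsto> lim ip (u n) g\<close> inherits translation invariance from \<open>u\<close>, so it takes the annihilated
  convolution of \<open>g\<close> with the kernel to its value at \<open>g\<close> times the non-zero mass of the kernel.\<close>

lemma ip_tendsto_0_Z_space:
  assumes u: "u \<in> b2_cauchy A" and inv: "\<And>y. (\<lambda>n. nrm (translate y (u n) - u n)) \<longlonglongrightarrow> 0"
    and g: "g \<in> Z_space A"
  shows "(\<lambda>n. ip (u n) g) \<longlonglongrightarrow> 0"
proof -
  have gA: "g \<in> A" and gap: "0 \<notin> dist_supp (fourier_dist g)"
    using g by (auto simp: Z_space_def)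
  note uA = b2_cauchy_mem[OF u]
  obtain k :: "real^'n \<Rightarrow> real" where k: "integrable lborel k" "(LINT x|lborel. k x) \<noteq> 0"
    and ann: "\<And>z. (LINT x|lborel. k x * g (z + x)) = 0"
    using spectral_gap_imp_annihilating_kernel[OF continuous_on_apply_bcontfun abs_bcontfun_le gap] by metis
  obtain L where L: "(\<lambda>n. ip (u n) g) \<longlonglongrightarrow> L"
    using ip_b2_cauchy_convergent[OF u gA] by (auto simp: convergent_def)
  obtain C where C: "\<And>n. \<bar>nrm (u n)\<bar> \<le> C"
    using convergent_imp_Bseq[OF nrm_b2_cauchy_convergent[OF u]] by (auto simp: Bseq_def)
  have lim: "(\<lambda>n. ip (u n) (translate y g)) \<longlonglongrightarrow> L" for y
  proof -
    \<comment> \<open>Invariance of the mean moves the translation from \<open>g\<close> to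
      \<open>u n\<close> with opposite sign, where \<open>inv\<close> applies.\<close>
    have "(\<lambda>n. ip (translate (- y) (u n) - u n) g) \<longlonglongrightarrow> 0"
    proof (rule Lim_null_comparison)
      show "(\<lambda>n. nrm (translate (- y) (u n) - u n) * nrm g) \<longlonglongrightarrow> 0"
        using tendsto_mult_left_zero[OF inv] .
    qed (auto intro!: always_eventually abs_ip_le mem_intros uA gA)
    from tendsto_add[OF this L]
    have "(\<lambda>n. ip (translate (- y) (u n)) g) \<longlonglongrightarrow> L"
      by (simp add: ip_diff_left mem_intros uA gA)
    moreover have "ip (translate (- y) (u n)) g = ip (u n) (translate y g)" for n
    proof -
      have "translate y (translate (- y) (u n)) = u n"
        by (rule bcontfun_eqI) (simp add: translate_apply)
      then show ?thesis
        using ip_translate[of "translate (- y) (u n)" g y] by (simp add: mem_intros uA gA)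
    qed
    ultimately show ?thesis by simp
  qed
  have "(\<lambda>n. LINT y|lborel. k y * ip (u n) (translate y g)) \<longlonglongrightarrow> (LINT y|lborel. k y * L)"
  proof (rule integral_dominated_convergence[where w="\<lambda>y. (C * norm g) * \<bar>k y\<bar>"])
    show "integrable lborel (\<lambda>y. (C * norm g) * \<bar>k y\<bar>)"
      using k by (intro integrable_mult_right integrable_abs)
    have "norm (k y * ip (u n) (translate y g)) \<le> (C * norm g) * \<bar>k y\<bar>" for n y
    proof -
      have "norm (translate y g) \<le> norm g"
        by (rule norm_bound) (simp add: translate_apply abs_bcontfun_le)
      then have "nrm (translate y g) \<le> norm g"
        using nrm_le_norm[of "translate y g"] gA by (simp add: mem_intros)
      then have "\<bar>ip (u n) (translate y g)\<bar> \<le> C * norm g"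
        using C[of n] by (intro order_trans[OF abs_ip_le] mult_mono) (auto intro!: mem_intros nrm_nonneg uA gA)
      from mult_left_mono[OF this abs_ge_zero[of "k y"]]
      show ?thesis by (simp add: abs_mult mult_ac)
    qed
    then show "AE y in lborel. norm (k y * ip (u n) (translate y g)) \<le> (C * norm g) * \<bar>k y\<bar>" for n
      by simp
    show "(\<lambda>y. k y * ip (u n) (translate y g)) \<in> borel_measurable lborel" for n
      by (rule ip_translate_measurable[OF uA gA k(1) ann])
  qed (use k lim in \<open>auto intro!: tendsto_intros\<close>)
  \<comment> \<open>Every term of the sequence is 0 by annihilation, hence so is the limit, which is
    L times the mass of \<open>k\<close>.\<close>
  then have "(LINT y|lborel. k y * L) = 0"
    by (simp add: integral_kernel_ip_translate[OF uA gA k(1) ann] LIMSEQ_const_iff)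
  then have "L = 0" using k(2) by simp
  with L show ?thesis by simp
qed

text \<open>The seminorms of \<open>u n\<close> are bounded, so replacing \<open>g\<close> by a
  uniformly close element of \<open>Z_space A\<close> costs an error independent of n.\<close>

lemma ip_tendsto_0_V_space:
  assumes reg: "regular A" and u: "u \<in> b2_cauchy A"
    and inv: "\<And>y. (\<lambda>n. nrm (translate y (u n) - u n)) \<longlonglongrightarrow> 0"
    and g: "g \<in> V_space A"
  shows "(\<lambda>n. ip (u n) g) \<longlonglongrightarrow> 0"
proof (rule LIMSEQ_I)
  fix e :: real assume e: "e > 0"
  note uA = b2_cauchy_mem[OF u]
  have gA: "g \<in> A" using g by (simp add: V_space_def)
  obtain C where C: "C > 0" "\<And>n. \<bar>nrm (u n)\<bar> \<le> C"
    using convergent_imp_Bseq[OF nrm_b2_cauchy_convergent[OF u]] by (auto simp: Bseq_def)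
  have "e / (2 * C) > 0" using e C by simp
  moreover have "g \<in> closure (Z_space A)" using g reg by (auto simp: regular_def)
  ultimately obtain h where h: "h \<in> Z_space A" "dist h g < e / (2 * C)"
    unfolding closure_approachable by blast
  have hA: "h \<in> A" using h by (simp add: Z_space_def)
  from LIMSEQ_D[OF ip_tendsto_0_Z_space[OF u inv h(1)], of "e / 2"] e
  obtain N where N: "\<And>n. n \<ge> N \<Longrightarrow> \<bar>ip (u n) h\<bar> < e / 2" by auto
  have "norm (ip (u n) g - 0) < e" if "n \<ge> N" for n
  proof -
    have "\<bar>ip (u n) (g - h)\<bar> \<le> nrm (u n) * nrm (g - h)"
      by (intro abs_ip_le mem_intros uA gA hA)
    also have "\<dots> \<le> C * norm (g - h)"
      using C(2)[of n] C(1) by (intro mult_mono nrm_le_norm nrm_nonneg mem_intros gA hA) auto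
    also have "\<dots> \<le> e / 2"
      using h(2) C(1) by (simp add: dist_norm norm_minus_commute field_simps)
    finally show ?thesis
      using N[OF that] ip_diff_right[OF gA hA uA, of n]
        abs_triangle_ineq[of "ip (u n) (g - h)" "ip (u n) h"] by simp
  qed
  then show "\<exists>N. \<forall>n\<ge>N. norm (ip (u n) g - 0) < e" by blast
qed

text \<open>\<open>ip_tendsto_0_V_space\<close> treats a fixed element, but
  \<open>u n - M (u n)\<close> moves with n. Freezing it at a late index N changes the pairing by
  little, uniformly in \<open>n \<ge> N\<close>.\<close>

lemma variance_tendsto_0:
  assumes reg: "regular A" and u: "u \<in> b2_cauchy A"
    and inv: "\<And>y. (\<lambda>n. nrm (translate y (u n) - u n)) \<longlonglongrightarrow> 0"
  shows "(\<lambda>n. ip (u n) (u n - const_bcontfun (M (u n)))) \<longlonglongrightarrow> 0"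
proof (rule LIMSEQ_I)
  fix e :: real assume e: "e > 0"
  note uA = b2_cauchy_mem[OF u]
  define g where "g n = u n - const_bcontfun (M (u n))" for n
  have gA: "g n \<in> A" for n unfolding g_def by (intro mem_intros uA)
  have gV: "g n \<in> V_space A" for n
    using gA[of n] M_diff[OF uA[of n] const_mem[of "M (u n)"]]
    by (simp only: V_space_def M_def[symmetric] g_def M_const) simp
  obtain C where C: "C > 0" "\<And>n. \<bar>nrm (u n)\<bar> \<le> C"
    using convergent_imp_Bseq[OF nrm_b2_cauchy_convergent[OF u]] by (auto simp: Bseq_def)
  \<comment> \<open>\<open>u n - u N\<close> and its mean each contribute once to
    \<open>g n - g N\<close>; with the bound \<open>C\<close> on the other factor the error is at
    most e/2.\<close>
  have "e / (4 * C) > 0" using e C by simp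
  from b2_cauchyD[OF u this] obtain N where
    N: "\<And>j k. j \<ge> N \<Longrightarrow> k \<ge> N \<Longrightarrow> nrm (u j - u k) < e / (4 * C)" by blast
  from LIMSEQ_D[OF ip_tendsto_0_V_space[OF reg u inv gV], of "e / 2" N] e
  obtain N' where N': "\<And>n. n \<ge> N' \<Longrightarrow> \<bar>ip (u n) (g N)\<bar> < e / 2" by auto
  have "norm (ip (u n) (g n) - 0) < e" if n: "n \<ge> max N N'" for n
  proof -
    have "g n - g N = (u n - u N) + const_bcontfun (M (u N) - M (u n))"
      unfolding g_def by (rule bcontfun_eqI) simp
    then have "nrm (g n - g N) \<le> nrm (u n - u N) + \<bar>M (u n - u N)\<bar>"
      using nrm_add_le[of "u n - u N" "const_bcontfun (M (u N) - M (u n))"]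
      by (simp add: mem_intros uA nrm_const M_diff abs_minus_commute)
    also have "\<dots> \<le> 2 * nrm (u n - u N)"
      using abs_M_le_nrm[of "u n - u N"] by (simp add: mem_intros uA)
    also have "\<dots> < e / (2 * C)"
      using N[of n N] n by simp
    finally have d: "nrm (g n - g N) \<le> e / (2 * C)" by simp
    have "\<bar>ip (u n) (g n - g N)\<bar> \<le> nrm (u n) * nrm (g n - g N)"
      by (intro abs_ip_le mem_intros uA gA)
    also have "\<dots> \<le> C * (e / (2 * C))"
      using C(2)[of n] C(1) d by (intro mult_mono nrm_nonneg mem_intros gA) auto
    also have "\<dots> = e / 2" using C(1) by simp
    finally show ?thesis
      using N'[of n] n ip_diff_right[OF gA[of n] gA[of N] uA, of n]
        abs_triangle_ineq[of "ip (u n) (g n - g N)" "ip (u n) (g N)"] by simp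
  qed
  then show "\<exists>N. \<forall>n\<ge>N. norm (ip (u n) (u n - const_bcontfun (M (u n))) - 0) < e"
    unfolding g_def by blast
qed

lemma regular_imp_ergodic:
  assumes reg: "regular A"
  shows "ergodic A"
  unfolding ergodic_def
proof (intro ballI impI)
  fix F assume F: "F \<in> B2 A" and inv0: "\<forall>y. b2_mean_sq (b2_diff A (b2_translate A y F) F) = 0"
  obtain u where u: "u \<in> b2_cauchy A" and Fu: "F = b2_rel A `` {u}"
    using F by (auto simp: B2_def elim: quotientE)
  note uA = b2_cauchy_mem[OF u]
  have inv: "(\<lambda>n. nrm (translate y (u n) - u n)) \<longlonglongrightarrow> 0" for y
  proof -
    note tu = translate_b2_cauchy[OF u, of y]
    have "(\<lambda>n. mean_sq (translate y (u n) - u n)) \<longlonglongrightarrow> 0"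
      using b2_mean_sq_class_tendsto[OF diff_b2_cauchy[OF tu u]] inv0[rule_format, of y]
      by (simp add: Fu b2_translate_class[OF u] b2_diff_class[OF tu u])
    from tendsto_real_sqrt[OF this] show ?thesis by (simp add: b2_seminorm_def)
  qed
  \<comment> \<open>The mean is the pairing with the constant 1, hence converges; its limit is the
    constant sought.\<close>
  have "convergent (\<lambda>n. ip (u n) (const_bcontfun 1))"
    by (rule ip_b2_cauchy_convergent[OF u const_mem])
  then obtain c where c: "(\<lambda>n. M (u n)) \<longlonglongrightarrow> c"
    by (auto simp: convergent_def ip_const_right uA)
  \<comment> \<open>Pythagoras: \<open>u n - M (u n)\<close> is orthogonal to constants, so the
    squared distance to \<open>c\<close> is the variance plus the squared error of the mean.\<close>
  have "ip (u n - const_bcontfun c) (u n - const_bcontfun c) =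
      ip (u n) (u n - const_bcontfun (M (u n))) + (M (u n) - c)\<^sup>2" for n
    by (simp add: ip_diff_left ip_diff_right mem_intros uA ip_const_right M_const M_diff
        ip_commute[of "const_bcontfun c" "u n"] power2_eq_square algebra_simps)
  moreover have "(\<lambda>n. ip (u n) (u n - const_bcontfun (M (u n))) + (M (u n) - c)\<^sup>2) \<longlonglongrightarrow> 0 + (c - c)\<^sup>2"
    by (intro tendsto_intros variance_tendsto_0[OF reg u inv] c)
  ultimately have "(\<lambda>n. ip (u n - const_bcontfun c) (u n - const_bcontfun c)) \<longlonglongrightarrow> 0"
    by simp
  from tendsto_real_sqrt[OF this] have lim: "(\<lambda>n. nrm (u n - const_bcontfun c)) \<longlonglongrightarrow> 0"
    by (simp add: nrm_eq)
  have "(\<lambda>n. const_bcontfun c) \<in> b2_cauchy A"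
    using nrm_const[of 0] by (auto simp: b2_cauchy_def const_mem)
  with u lim have "(u, \<lambda>n. const_bcontfun c) \<in> b2_rel A"
    by (simp add: b2_rel_def)
  from equiv_class_eq[OF equiv_b2_rel this]
  show "\<exists>c. F = b2_const A c"
    by (auto simp: Fu b2_const_def)
qed

end

theorem proposition3p1:
  fixes A :: "((real^'n) \<Rightarrow>\<^sub>C real) set"
  assumes "algebra_with_mean_value A"
    and "regular A"
  shows "ergodic A"
  by (rule mean_value_algebra.regular_imp_ergodic[OF mean_value_algebra.intro[OF assms(1)] assms(2)])

end
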